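(* Let $\Omega\subset\mathbb{R}^N$ be an unbounded domain. Let $a\in C(\bar\Omega)\cap L^\infty(\Omega)$, and let $K:\Omega\times\Omega\to[0,\infty)$ be such that for every $x\in\Omega$ the map $K(x,\cdot)$ is measurable, for almost every $y\in\Omega$ the map $K(\cdot,y)$ is uniformly continuous, and there exist constants $r_0\ge r_1>0$, $C_0\ge c_0>0$ with $$C_0\,\mathbb{1}_{\Omega\cap B_{r_0}(x)}(y)\ \ge\ K(x,y)\ \ge\ c_0\,\mathbb{1}_{\Omega\cap B_{r_1}(x)}(y)\qquad\text{for all }x,y\in\Omega.$$ Then $$\lambda_p'(\mathcal{L}_\Omega+a)\le\lambda_p''(\mathcal{L}_\Omega+a)\le\lambda_p(\mathcal{L}_\Omega+a).$$ If moreover $K$ is symmetric and $p(x):=\int_\Omega K(x,y)\,dy$ belongs to $L^\infty(\Omega)$, then $$\lambda_v(\mathcal{L}_\Omega+a)=\lambda_p'(\mathcal{L}_\Omega+a)=\lambda_p''(\mathcal{L}_\Omega+a)=\lambda_p(\mathcal{L}_\Omega+a).$$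
   Context: For $\varphi\in C(\bar\Omega)$, $\mathcal{L}_\Omega[\varphi](x):=\int_\Omega K(x,y)\varphi(y)\,dy$. $B_r(x)$ is the open ball of radius $r$ centred at $x$ and $\mathbb{1}_A$ the indicator of $A$. The quantities are defined as: $\lambda_p(\mathcal{L}_\Omega+a):=\sup\{\lambda\in\mathbb{R}:\exists\varphi\in C(\bar\Omega),\ \varphi>0,\ \mathcal{L}_\Omega[\varphi]+a\varphi+\lambda\varphi\le0\text{ in }\Omega\}$; $\lambda_p'(\mathcal{L}_\Omega+a):=\inf\{\lambda\in\mathbb{R}:\exists\varphi\in C(\Omega)\cap L^\infty(\Omega),\ \varphi\ge0,\ \varphi\not\equiv0,\ \mathcal{L}_\Omega[\varphi]+(a+\lambda)\varphi\ge0\text{ in }\Omega\}$; $\lambda_p''(\mathcal{L}_\Omega+a):=\inf\{\lambda\in\mathbb{R}:\exists\varphi\in C_c(\Omega),\ \varphi\ge0,\ \varphi\not\equiv0,\ \mathcal{L}_\Omega[\varphi]+(a+\lambda)\varphi\ge0\text{ in }\Omega\}$; $\lambda_v(\mathcal{L}_\Omega+a):=\inf_{\varphi\in L^2(\Omega),\varphi\not\equiv0}\ -\frac{\langle\mathcal{L}_\Omega[\varphi]+a\varphi,\varphi\rangle}{\|\varphi\|_{L^2(\Omega)}^2}$, with $\langle\cdot,\cdot\rangle$ the $L^2(\Omega)$ scalar product. *)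

theory Defs
  imports "HOL-Analysis.Analysis"
begin

definition nlop :: "'a::euclidean_space set \<Rightarrow> ('a \<Rightarrow> 'a \<Rightarrow> real) \<Rightarrow> ('a \<Rightarrow> real) \<Rightarrow> 'a \<Rightarrow> real" where
  "nlop \<Omega> K \<phi> x = integral\<^sup>L (lebesgue_on \<Omega>) (\<lambda>y. K x y * \<phi> y)"

definition lambda_p :: "'a::euclidean_space set \<Rightarrow> ('a \<Rightarrow> 'a \<Rightarrow> real) \<Rightarrow> ('a \<Rightarrow> real) \<Rightarrow> ereal" where
  "lambda_p \<Omega> K a = Sup {ereal l | l. \<exists>\<phi>. continuous_on (closure \<Omega>) \<phi> \<and>
      (\<forall>x\<in>closure \<Omega>. \<phi> x > 0) \<and>
      (\<forall>x\<in>\<Omega>. nlop \<Omega> K \<phi> x + a x * \<phi> x + l * \<phi> x \<le> 0)}"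

definition lambda_p' :: "'a::euclidean_space set \<Rightarrow> ('a \<Rightarrow> 'a \<Rightarrow> real) \<Rightarrow> ('a \<Rightarrow> real) \<Rightarrow> ereal" where
  "lambda_p' \<Omega> K a = Inf {ereal l | l. \<exists>\<phi>. continuous_on \<Omega> \<phi> \<and> bounded (\<phi> ` \<Omega>) \<and>
      (\<forall>x\<in>\<Omega>. \<phi> x \<ge> 0) \<and> (\<exists>x\<in>\<Omega>. \<phi> x \<noteq> 0) \<and>
      (\<forall>x\<in>\<Omega>. nlop \<Omega> K \<phi> x + (a x + l) * \<phi> x \<ge> 0)}"

definition Cc_on :: "'a::euclidean_space set \<Rightarrow> ('a \<Rightarrow> real) \<Rightarrow> bool" where
  "Cc_on \<Omega> \<phi> \<longleftrightarrow> continuous_on \<Omega> \<phi> \<and>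
      (\<exists>S. compact S \<and> S \<subseteq> \<Omega> \<and> (\<forall>x\<in>\<Omega> - S. \<phi> x = 0))"

definition lambda_p'' :: "'a::euclidean_space set \<Rightarrow> ('a \<Rightarrow> 'a \<Rightarrow> real) \<Rightarrow> ('a \<Rightarrow> real) \<Rightarrow> ereal" where
  "lambda_p'' \<Omega> K a = Inf {ereal l | l. \<exists>\<phi>. Cc_on \<Omega> \<phi> \<and>
      (\<forall>x\<in>\<Omega>. \<phi> x \<ge> 0) \<and> (\<exists>x\<in>\<Omega>. \<phi> x \<noteq> 0) \<and>
      (\<forall>x\<in>\<Omega>. nlop \<Omega> K \<phi> x + (a x + l) * \<phi> x \<ge> 0)}"

definition L2_on :: "'a::euclidean_space set \<Rightarrow> ('a \<Rightarrow> real) \<Rightarrow> bool" where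
  "L2_on \<Omega> \<phi> \<longleftrightarrow> \<phi> \<in> borel_measurable (lebesgue_on \<Omega>) \<and>
      integrable (lebesgue_on \<Omega>) (\<lambda>x. (\<phi> x)\<^sup>2)"

definition lambda_v :: "'a::euclidean_space set \<Rightarrow> ('a \<Rightarrow> 'a \<Rightarrow> real) \<Rightarrow> ('a \<Rightarrow> real) \<Rightarrow> ereal" where
  "lambda_v \<Omega> K a = Inf {ereal (- (integral\<^sup>L (lebesgue_on \<Omega>)
          (\<lambda>x. (nlop \<Omega> K \<phi> x + a x * \<phi> x) * \<phi> x))
        / integral\<^sup>L (lebesgue_on \<Omega>) (\<lambda>x. (\<phi> x)\<^sup>2)) | \<phi>.
      L2_on \<Omega> \<phi> \<and> \<not> (AE x in lebesgue_on \<Omega>. \<phi> x = 0)}"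

end

(* If a + l <= 0 and l' < l, put b = -(a + l') and T g = L g / b. Suppose that l is below
   lambda_p'', so that no compactly supported phi satisfies T phi >= theta phi for a suitable
   theta < 1. Applied to the truncated Neumann series of a bump f (with T multiplied by a cutoff),
   this bounds the local mass of T^k f near supp f by C theta^k. Since the lower kernel bound holds
   on balls of the fixed radius r1, the bound spreads through the connected set Omega and, by
   compactness, is uniform on its bounded subsets even up to the boundary. Hence the sum G of the
   T^k f converges, and T G <= G is a positive supersolution for l', which extends continuously to
   the closure by dominated convergence; so l' <= lambda_p.

   With a symmetric kernel, lambda_p <= lambda_v by weighting psi(x) psi(y) with AM-GM against a
   supersolution phi, and lambda_v <= lambda_p' by testing with a bounded subsolution truncated
   to a ball of radius R, where R is chosen by polynomial volume growth such that the boundary layer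
   of width r0 carries a negligible part of the L2 norm. *)

theory Submission
  imports Defs
begin

section \<open>Topological and measure-theoretic preliminaries\<close>

text \<open>The boundary of the domain may be arbitrarily irregular, and subsolutions in the
  definition of \<open>lambda_p''\<close> must vanish near it, while \<open>T\<close> may carry mass
  up to it. Hence the cutoffs: every estimate made with them is uniform in the cutoff, so they can
  be removed by dominated convergence. Pointwise bounds of Harnack type are replaced by integrals
  over balls intersected with the domain. One application of \<open>L\<close> is bounded above by
  such an integral at radius \<open>r0\<close> and below at radius \<open>r1\<close>, with constants
  that ignore the distance to the boundary.

  The number theta comes from the gap between l' and l. Since a + l = -(b - (l - l')) and b \<le>
  beta, the choice theta = 1 - (l - l') / beta gives b - (l - l') \<le> theta b, so a function phi
  \<ge> 0 with L phi \<ge> theta b phi would be a subsolution for l.\<close>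

lemma sigma_finite_lebesgue_on:
  fixes \<Omega> :: "'a::euclidean_space set"
  assumes "\<Omega> \<in> sets lebesgue"
  shows "sigma_finite_measure (lebesgue_on \<Omega>)"
proof (rule sigma_finite_measure_restrict_space[OF _ assms])
  let ?A = "range (\<lambda>n::nat. ball (0::'a) (real n))"
  have "emeasure lebesgue (ball (0::'a) (real n)) \<noteq> \<infinity>" for n :: nat
    using emeasure_lborel_ball_finite[of "0::'a" "real n"] by simp
  moreover have "\<Union> ?A = space lebesgue"
    using reals_Archimedean2 by (auto simp: set_eq_iff)
  moreover have "countable ?A" "?A \<subseteq> sets lebesgue"
    by auto
  ultimately show "sigma_finite_measure (lebesgue :: 'a measure)"
    by (intro sigma_finite_measure.intro exI[of _ ?A] conjI) auto
qed

text \<open>Two points of \<open>S\<close> in one ball of radius \<open>e/2\<close> are closer than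
  \<open>e\<close>, so \<open>P\<close> is locally constant on \<open>S\<close>, and connectedness
  does the rest. The step length is fixed: a step need not stay in a ball contained in
  \<open>S\<close>.\<close>

lemma connected_chain_induct [consumes 4, case_names step]:
  fixes S :: "'a::metric_space set"
  assumes "connected S" "x \<in> S" "P x" "0 < e"
    and step: "\<And>z w. z \<in> S \<Longrightarrow> w \<in> S \<Longrightarrow> dist z w < e \<Longrightarrow> P z \<Longrightarrow> P w"
    and "z \<in> S"
  shows "P z"
proof (rule connected_induction_simple[OF \<open>connected S\<close> \<open>x \<in> S\<close> \<open>z \<in> S\<close>, of P, OF \<open>P x\<close>])
  fix y assume "y \<in> S"
  have "P v" if "u \<in> S \<inter> ball y (e/2)" "v \<in> S \<inter> ball y (e/2)" "P u" for u v
  proof (rule step[of u v])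
    show "dist u v < e"
      by (rule dist_triangle_half_r[of y]) (use that in simp_all)
  qed (use that in simp_all)
  moreover have "openin (top_of_set S) (S \<inter> ball y (e/2))"
    by (simp add: openin_open_Int)
  moreover have "y \<in> S \<inter> ball y (e/2)"
    using \<open>y \<in> S\<close> \<open>0 < e\<close> by simp
  ultimately show "\<exists>T. openin (top_of_set S) T \<and> y \<in> T \<and> (\<forall>u\<in>T. \<forall>v\<in>T. P u \<longrightarrow> P v)"
    by blast
qed

text \<open>For \<open>L g\<close> with \<open>g\<close> locally integrable, limits at single
  boundary points are available but no global modulus of continuity. Such limits suffice because the
  target space is regular.\<close>

lemma continuous_on_extend_to_closure:
  fixes f :: "'a::topological_space \<Rightarrow> 'b::metric_space"
  assumes f: "continuous_on S f"
    and lim: "\<And>x. x \<in> closure S \<Longrightarrow> x \<notin> S \<Longrightarrow> \<exists>l. (f \<longlongrightarrow> l) (at x within S)"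
  obtains g where "continuous_on (closure S) g" "\<And>x. x \<in> S \<Longrightarrow> g x = f x"
proof -
  obtain g where "continuous_map (subtopology euclidean (closure S)) euclidean g" "\<And>x. x \<in> S \<Longrightarrow> g x = f x"
  proof (rule continuous_map_extension_pointwise_alt[of euclidean S "closure S" euclidean f])
    show "regular_space (euclidean :: 'b topology)"
      by (simp add: regular_space_euclidean)
      show "\<exists>l. limitin euclidean f l (atin_within euclidean x S)" if "x \<in> closure S - S" for x
    proof -
      have "atin_within euclidean x S = at x within S"
        unfolding filter_eq_iff
        by (auto simp: eventually_atin_within eventually_at_topological)
      then show ?thesis
        using lim that by simp
    qed
  qed (use f in \<open>auto simp: closure_subset\<close>)
  then show ?thesis using that by auto
qed

text \<open>Urysohn functions for a compact exhaustion. Being eventually 1 on each compact set, and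
  not merely tending to 1 pointwise, makes the cutoff invisible on a whole ball once
  \<open>n\<close> is large.\<close>

lemma Cc_on_cutoffs:
  fixes \<Omega> :: "'a::euclidean_space set"
  assumes "open \<Omega>"
  obtains \<eta> :: "nat \<Rightarrow> 'a \<Rightarrow> real" where
    "\<And>n. Cc_on \<Omega> (\<eta> n)" "\<And>n x. 0 \<le> \<eta> n x" "\<And>n x. \<eta> n x \<le> 1"
    "\<And>S. compact S \<Longrightarrow> S \<subseteq> \<Omega> \<Longrightarrow> \<exists>N. \<forall>n\<ge>N. \<forall>x\<in>S. \<eta> n x = 1"
proof -
  obtain C where C: "\<And>n. compact (C n)" "\<And>n. C n \<subseteq> \<Omega>" "\<And>n. C n \<subseteq> interior (C (Suc n))"
      "\<And>S. compact S \<Longrightarrow> S \<subseteq> \<Omega> \<Longrightarrow> \<exists>N. \<forall>n\<ge>N. S \<subseteq> C n"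
    using open_Union_compact_subsets[OF assms] by metis
  have "\<exists>f. continuous_on UNIV f \<and> (\<forall>x. f x \<in> closed_segment 0 (1::real)) \<and>
      (\<forall>x \<in> - interior (C (Suc n)). f x = 0) \<and> (\<forall>x\<in>C n. f x = 1)" for n
  proof (rule Urysohn[of "- interior (C (Suc n))" "C n" 0 "1::real"])
    show "- interior (C (Suc n)) \<inter> C n = {}"
      using C(3)[of n] by blast
  qed (use C(1) compact_imp_closed in \<open>auto\<close>)
  then obtain \<eta> where \<eta>: "\<And>n. continuous_on UNIV (\<eta> n)" "\<And>n x. \<eta> n x \<in> closed_segment 0 (1::real)"
      "\<And>n x. x \<notin> interior (C (Suc n)) \<Longrightarrow> \<eta> n x = 0" "\<And>n x. x \<in> C n \<Longrightarrow> \<eta> n x = 1"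
    by (metis ComplI)
  show thesis
  proof
    show "Cc_on \<Omega> (\<eta> n)" for n
      unfolding Cc_on_def
    proof (intro conjI exI[of _ "C (Suc n)"] ballI)
      show "continuous_on \<Omega> (\<eta> n)"
        using \<eta>(1) by (rule continuous_on_subset) simp
      show "\<eta> n x = 0" if "x \<in> \<Omega> - C (Suc n)" for x
        using that \<eta>(3)[of x n] interior_subset[of "C (Suc n)"] by blast
    qed (rule C)+
    show "0 \<le> \<eta> n x" "\<eta> n x \<le> 1" for n x
      using \<eta>(2)[of n x] by (auto simp: closed_segment_eq_real_ivl)
    show "\<exists>N. \<forall>n\<ge>N. \<forall>x\<in>S. \<eta> n x = 1" if "compact S" "S \<subseteq> \<Omega>" for S
      using C(4)[OF that] \<eta>(4) by blast
  qed
qed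

lemma Cc_on_sum:
  assumes "\<And>i. i \<in> I \<Longrightarrow> Cc_on \<Omega> (g i)" "finite I"
  shows "Cc_on \<Omega> (\<lambda>x. \<Sum>i\<in>I. g i x)"
proof -
  obtain S where S: "\<And>i. i \<in> I \<Longrightarrow> compact (S i) \<and> S i \<subseteq> \<Omega> \<and> (\<forall>x\<in>\<Omega> - S i. g i x = 0)"
    using assms(1) unfolding Cc_on_def by metis
  show ?thesis
    unfolding Cc_on_def
  proof (intro conjI exI[of _ "\<Union>(S ` I)"])
    show "continuous_on \<Omega> (\<lambda>x. \<Sum>i\<in>I. g i x)"
      using assms(1) by (intro continuous_on_sum) (simp add: Cc_on_def)
    show "compact (\<Union>(S ` I))"
      using S assms(2) by (intro compact_UN) auto
    show "\<Union>(S ` I) \<subseteq> \<Omega>"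
      using S by blast
    show "\<forall>x\<in>\<Omega> - \<Union>(S ` I). (\<Sum>i\<in>I. g i x) = 0"
      using S by (auto intro!: sum.neutral)
  qed
qed

lemma Cc_on_mult:
  assumes "Cc_on \<Omega> g" "continuous_on \<Omega> h"
  shows "Cc_on \<Omega> (\<lambda>x. g x * h x)"
  using assms unfolding Cc_on_def by (auto intro: continuous_on_mult)

lemma Cc_on_bounded:
  fixes \<Omega> :: "'a::euclidean_space set"
  assumes "Cc_on \<Omega> g"
  shows "bounded (g ` \<Omega>)"
proof -
  obtain S where S: "compact S" "S \<subseteq> \<Omega>" "\<forall>x\<in>\<Omega> - S. g x = 0"
    using assms unfolding Cc_on_def by blast
  have "bounded (g ` S)"
    using S assms unfolding Cc_on_def
    by (intro compact_imp_bounded compact_continuous_image) (auto intro: continuous_on_subset)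
  moreover have "g ` \<Omega> \<subseteq> insert 0 (g ` S)"
    using S(3) by auto
  ultimately show ?thesis
    by (meson bounded_insert bounded_subset)
qed

lemma Cc_on_bump:
  fixes x :: "'a::euclidean_space"
  assumes "cball x r \<subseteq> \<Omega>"
  shows "Cc_on \<Omega> (\<lambda>y. max 0 (r - dist x y))"
  unfolding Cc_on_def
proof (intro conjI exI[of _ "cball x r"])
  show "continuous_on \<Omega> (\<lambda>y. max 0 (r - dist x y))"
    by (intro continuous_intros)
qed (use assms in auto)

section \<open>The nonlocal operator\<close>

locale nonlocal_kernel =
  fixes \<Omega> :: "'a::euclidean_space set"
    and K :: "'a \<Rightarrow> 'a \<Rightarrow> real"
    and r0 r1 C0 c0 :: real
  assumes open_dom: "open \<Omega>" and connected_dom: "connected \<Omega>" and nonempty_dom: "\<Omega> \<noteq> {}"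
    and K_nonneg: "\<And>x y. x \<in> \<Omega> \<Longrightarrow> y \<in> \<Omega> \<Longrightarrow> 0 \<le> K x y"
    and K_meas: "\<And>x. x \<in> \<Omega> \<Longrightarrow> K x \<in> borel_measurable (lebesgue_on \<Omega>)"
    and K_ucont: "AE y in lebesgue_on \<Omega>. uniformly_continuous_on \<Omega> (\<lambda>x. K x y)"
    and r1_pos: "0 < r1" and r1_le: "r1 \<le> r0" and c0_pos: "0 < c0" and c0_le: "c0 \<le> C0"
    and K_le: "\<And>x y. x \<in> \<Omega> \<Longrightarrow> y \<in> \<Omega> \<Longrightarrow> K x y \<le> C0 * indicator (ball x r0) y"
    and K_ge: "\<And>x y. x \<in> \<Omega> \<Longrightarrow> y \<in> \<Omega> \<Longrightarrow> c0 * indicator (ball x r1) y \<le> K x y"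
begin

abbreviation "M \<equiv> lebesgue_on \<Omega>"

abbreviation "L \<equiv> nlop \<Omega> K"

text \<open>Integrability on all bounded parts of \<open>\<Omega>\<close> up to the boundary, which
  is more than local integrability in the open set. Since \<open>K x\<close> vanishes beyond
  distance \<open>r0\<close>, this makes \<open>L g\<close> meaningful at every point without any
  condition at infinity.\<close>

definition locint :: "('a \<Rightarrow> real) \<Rightarrow> bool" where
  "locint g \<longleftrightarrow> g \<in> borel_measurable M \<and> (\<forall>R. integrable M (\<lambda>y. indicator (ball 0 R) y * g y))"

text \<open>Masses stand in for pointwise values: \<open>L_le_mass\<close> and
  \<open>mass_le_L\<close> bound \<open>L g\<close> by them from both sides.\<close>

definition mass :: "'a \<Rightarrow> real \<Rightarrow> ('a \<Rightarrow> real) \<Rightarrow> real" where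
  "mass z r g = (\<integral>y. indicator (ball z r) y * g y \<partial>M)"

lemma r0_pos: "0 < r0" and C0_pos: "0 < C0"
  using r1_pos r1_le c0_pos c0_le by auto

lemma sets_dom: "\<Omega> \<in> sets lebesgue"
  using open_dom by auto

lemma sigma_finite_M: "sigma_finite_measure M"
  using sets_dom by (rule sigma_finite_lebesgue_on)

lemma borel_imp_measurable_M: "f \<in> borel_measurable borel \<Longrightarrow> f \<in> borel_measurable M"
  by (intro measurable_restrict_space1 measurable_completion) simp

lemma indicator_ball_measurable [measurable]:
  "(indicator (ball z r) :: 'a \<Rightarrow> real) \<in> borel_measurable M"
  by (intro borel_imp_measurable_M borel_measurable_indicator) auto

lemma continuous_measurable: "continuous_on \<Omega> g \<Longrightarrow> g \<in> borel_measurable M" for g :: "'a \<Rightarrow> real"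
  using continuous_imp_measurable_on_sets_lebesgue sets_dom by blast

lemma integrable_indicator_ball: "integrable M (indicator (ball z r) :: 'a \<Rightarrow> real)"
proof -
  have "\<Omega> \<inter> ball z r \<in> lmeasurable"
    using open_dom by (intro bounded_set_imp_lmeasurable) auto
  then have "integrable lebesgue (indicator (\<Omega> \<inter> ball z r) :: 'a \<Rightarrow> real)"
    by (intro integrable_real_indicator) (auto simp: fmeasurable_def)
  moreover have "indicator (\<Omega> \<inter> ball z r) = (\<lambda>x. indicator \<Omega> x *\<^sub>R (indicator (ball z r) x :: real))"
    by (auto simp: indicator_def)
  ultimately show ?thesis
    using sets_dom by (simp add: integrable_restrict_space)
qed

section \<open>Local integrability and linearity of the operator\<close>

lemma locint_measurable: "locint g \<Longrightarrow> g \<in> borel_measurable M"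
  by (simp add: locint_def)

lemma locint_bounded:
  assumes g: "g \<in> borel_measurable M"
    and bnd: "\<And>R. \<exists>B. \<forall>y\<in>\<Omega>. norm y < R \<longrightarrow> \<bar>g y\<bar> \<le> B"
  shows "locint g"
  unfolding locint_def
proof (intro conjI allI)
  fix R
  obtain B where B: "\<And>y. y \<in> \<Omega> \<Longrightarrow> norm y < R \<Longrightarrow> \<bar>g y\<bar> \<le> B"
    using bnd by blast
  show "integrable M (\<lambda>y. indicator (ball 0 R) y * g y)"
  proof (rule Bochner_Integration.integrable_bound)
    show "integrable M (\<lambda>y. B * indicator (ball 0 R) y)"
      using integrable_indicator_ball by simp
    show "(\<lambda>y. indicator (ball 0 R) y * g y) \<in> borel_measurable M"
      using g by measurable
    show "AE y in M. norm (indicator (ball 0 R) y * g y) \<le> norm (B * indicator (ball 0 R) y)"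
    proof (rule AE_I2)
      fix y assume "y \<in> space M"
      then show "norm (indicator (ball 0 R) y * g y) \<le> norm (B * indicator (ball 0 R) y)"
        using B[of y] by (auto simp: indicator_def)
    qed
  qed
qed (rule g)

lemma locint_ball:
  assumes "locint g"
  shows "integrable M (\<lambda>y. indicator (ball z r) y * g y)"
proof (rule Bochner_Integration.integrable_bound)
  show "integrable M (\<lambda>y. indicator (ball 0 (norm z + r)) y * g y)"
    using assms by (simp add: locint_def)
  show "(\<lambda>y. indicator (ball z r) y * g y) \<in> borel_measurable M"
    using locint_measurable[OF assms] by measurable
  have "ball z r \<subseteq> ball 0 (norm z + r)"
    by (simp add: ball_subset_ball_iff dist_norm)
  then show "AE y in M. norm (indicator (ball z r) y * g y) \<le> norm (indicator (ball 0 (norm z + r)) y * g y)"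
    by (intro AE_I2) (auto simp: indicator_def subset_iff)
qed

lemma locint_add: "locint g \<Longrightarrow> locint h \<Longrightarrow> locint (\<lambda>y. g y + h y)"
  by (auto simp: locint_def distrib_left)

lemma locint_cmult: "locint g \<Longrightarrow> locint (\<lambda>y. c * g y)"
  by (auto simp: locint_def mult.left_commute)

text \<open>Continuity up to the boundary excludes blow-up there, because
  \<open>closure \<Omega> \<inter> cball 0 R\<close> is compact.\<close>

lemma locint_continuous:
  assumes "continuous_on (closure \<Omega>) g"
  shows "locint g"
proof (rule locint_bounded)
  show "g \<in> borel_measurable M"
    using assms by (meson closure_subset continuous_measurable continuous_on_subset)
  fix R
  have "compact (closure \<Omega> \<inter> cball 0 R)"
    by (simp add: closed_Int_compact)
  then have "bounded (g ` (closure \<Omega> \<inter> cball 0 R))"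
    using assms by (intro compact_imp_bounded compact_continuous_image) (auto intro: continuous_on_subset)
  then obtain B where "\<And>y. y \<in> closure \<Omega> \<inter> cball 0 R \<Longrightarrow> \<bar>g y\<bar> \<le> B"
    by (metis bounded_iff imageI real_norm_def)
  then show "\<exists>B. \<forall>y\<in>\<Omega>. norm y < R \<longrightarrow> \<bar>g y\<bar> \<le> B"
    using closure_subset[of \<Omega>] by (intro exI[of _ B]) auto
qed

lemma K_integrable:
  assumes "locint g" "x \<in> \<Omega>"
  shows "integrable M (\<lambda>y. K x y * g y)"
proof (rule Bochner_Integration.integrable_bound)
  show "integrable M (\<lambda>y. C0 * (indicator (ball x r0) y * g y))"
    using locint_ball[OF assms(1)] by simp
  show "(\<lambda>y. K x y * g y) \<in> borel_measurable M"
    using locint_measurable[OF assms(1)] K_meas[OF assms(2)] by measurable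
  show "AE y in M. norm (K x y * g y) \<le> norm (C0 * (indicator (ball x r0) y * g y))"
  proof (rule AE_I2)
    fix y assume "y \<in> space M"
    then have "y \<in> \<Omega>" by simp
    then have "\<bar>K x y\<bar> \<le> \<bar>C0 * indicator (ball x r0) y\<bar>"
      using K_le[OF assms(2), of y] K_nonneg[OF assms(2), of y] by simp
    then have "\<bar>K x y\<bar> * \<bar>g y\<bar> \<le> \<bar>C0 * indicator (ball x r0) y\<bar> * \<bar>g y\<bar>"
      by (rule mult_right_mono) simp
    then show "norm (K x y * g y) \<le> norm (C0 * (indicator (ball x r0) y * g y))"
      by (simp add: abs_mult)
  qed
qed

lemma L_add:
  assumes "locint g" "locint h" "x \<in> \<Omega>"
  shows "L (\<lambda>y. g y + h y) x = L g x + L h x"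
  unfolding nlop_def distrib_left
  by (rule Bochner_Integration.integral_add) (use assms K_integrable in auto)

lemma L_cmult: "L (\<lambda>y. c * g y) x = c * L g x"
  unfolding nlop_def by (simp add: mult.left_commute)

lemma L_sum:
  assumes "\<And>i. i \<in> I \<Longrightarrow> locint (g i)" "x \<in> \<Omega>"
  shows "L (\<lambda>y. \<Sum>i\<in>I. g i y) x = (\<Sum>i\<in>I. L (g i) x)"
  unfolding nlop_def sum_distrib_left
  by (rule Bochner_Integration.integral_sum) (use assms K_integrable in auto)

lemma L_mono:
  assumes "locint g" "locint h" "x \<in> \<Omega>" "\<And>y. y \<in> \<Omega> \<Longrightarrow> g y \<le> h y"
  shows "L g x \<le> L h x"
  unfolding nlop_def
  by (rule integral_mono) (use assms K_integrable K_nonneg in \<open>auto intro: mult_left_mono\<close>)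

lemma L_nonneg:
  assumes "x \<in> \<Omega>" "\<And>y. y \<in> \<Omega> \<Longrightarrow> 0 \<le> g y"
  shows "0 \<le> L g x"
  unfolding nlop_def
  by (rule integral_nonneg_AE) (use assms K_nonneg in auto)

lemma locint_dominated:
  assumes "locint h" "g \<in> borel_measurable M" "\<And>y. y \<in> \<Omega> \<Longrightarrow> \<bar>g y\<bar> \<le> \<bar>h y\<bar>"
  shows "locint g"
  unfolding locint_def
proof (intro conjI allI)
  fix R
  show "integrable M (\<lambda>y. indicator (ball 0 R) y * g y)"
  proof (rule Bochner_Integration.integrable_bound[OF locint_ball[OF assms(1)]])
    show "(\<lambda>y. indicator (ball 0 R) y * g y) \<in> borel_measurable M"
      using assms(2) by measurable
    show "AE y in M. norm (indicator (ball 0 R) y * g y) \<le> norm (indicator (ball 0 R) y * h y)"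
      by (rule AE_I2) (use assms(3) in \<open>auto simp: abs_mult indicator_def\<close>)
  qed
qed (rule assms(2))

section \<open>Masses on balls and their comparison with the operator\<close>

lemma mass_mono:
  assumes "locint g" "locint h" "\<And>y. y \<in> \<Omega> \<Longrightarrow> y \<in> ball z r \<Longrightarrow> g y \<le> h y"
  shows "mass z r g \<le> mass z r h"
  unfolding mass_def
  by (rule integral_mono) (use assms locint_ball in \<open>auto simp: indicator_def\<close>)

lemma mass_ball_mono:
  assumes "locint g" "\<And>y. y \<in> \<Omega> \<Longrightarrow> 0 \<le> g y" "ball z r \<subseteq> ball w s"
  shows "mass z r g \<le> mass w s g"
  unfolding mass_def
proof (rule integral_mono)
  fix y assume "y \<in> space M"
  then show "indicator (ball z r) y * g y \<le> indicator (ball w s) y * g y"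
    using assms(2)[of y] subsetD[OF assms(3), of y] by (cases "y \<in> ball z r") auto
qed (use assms locint_ball in auto)

lemma locint_const: "locint (\<lambda>y. c)"
  by (rule locint_bounded) auto

text \<open>A small ball around \<open>z\<close> lies inside the open set. No bound uniform in
  \<open>z\<close> is claimed: near a cusp of the boundary the volume may tend to 0.\<close>

lemma mass_const_pos:
  assumes "z \<in> \<Omega>" "0 < r"
  shows "0 < mass z r (\<lambda>y. 1)"
proof -
  obtain e where e: "0 < e" "ball z e \<subseteq> \<Omega>"
    using open_dom assms(1) by (rule openE)
  define d where "d = min e r"
  have d: "0 < d" "ball z d \<subseteq> \<Omega>" "ball z d \<subseteq> ball z r"
    using e assms(2) by (auto simp: d_def)
  have "mass z d (\<lambda>y. 1) = measure M (ball z d)"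
  proof -
    have "mass z d (\<lambda>y. 1) = (\<integral>y. indicator (ball z d) y \<partial>M)"
      by (simp add: mass_def)
    also have "\<dots> = measure M (ball z d \<inter> space M)"
      by (rule Bochner_Integration.integral_indicator)
    finally show ?thesis
      using d(2) by (simp add: Int_absorb2)
  qed
  also have "\<dots> = measure lebesgue (ball z d)"
    using d(2) sets_dom by (intro measure_restrict_space) auto
  finally have "0 < mass z d (\<lambda>y. 1)"
    using content_ball_pos[OF d(1), of z] by simp
  also have "\<dots> \<le> mass z r (\<lambda>y. 1)"
    using d(3) by (intro mass_ball_mono locint_const) auto
  finally show ?thesis .
qed

lemma mass_ge_const:
  assumes "locint g" "\<And>y. y \<in> \<Omega> \<Longrightarrow> y \<in> ball z r \<Longrightarrow> c \<le> g y"
  shows "c * mass z r (\<lambda>y. 1) \<le> mass z r g"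
proof -
  have "c * mass z r (\<lambda>y. 1) = mass z r (\<lambda>y. c)"
    by (simp add: mass_def mult.commute)
  also have "\<dots> \<le> mass z r g"
    using assms by (intro mass_mono locint_const) auto
  finally show ?thesis .
qed

lemma mass_nonneg: "(\<And>y. y \<in> \<Omega> \<Longrightarrow> 0 \<le> g y) \<Longrightarrow> 0 \<le> mass z r g"
  unfolding mass_def by (rule integral_nonneg_AE) auto

lemma L_le_mass:
  assumes "locint g" "x \<in> \<Omega>" "\<And>y. y \<in> \<Omega> \<Longrightarrow> 0 \<le> g y" "ball x r0 \<subseteq> ball z R"
  shows "L g x \<le> C0 * mass z R g"
proof -
  have "(\<integral>y. K x y * g y \<partial>M) \<le> (\<integral>y. C0 * (indicator (ball z R) y * g y) \<partial>M)"
  proof (rule integral_mono)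
    fix y assume "y \<in> space M"
    then have y: "y \<in> \<Omega>" by simp
    have "K x y \<le> C0 * indicator (ball z R) y"
      using K_le[OF assms(2) y] assms(4) C0_pos by (cases "y \<in> ball x r0") (auto simp: indicator_def)
    then show "K x y * g y \<le> C0 * (indicator (ball z R) y * g y)"
      using mult_right_mono[OF _ assms(3)[OF y]] by (metis mult.assoc)
  qed (use assms K_integrable locint_ball in auto)
  then show ?thesis
    by (simp add: nlop_def mass_def)
qed

text \<open>This is where the lower bound on \<open>K\<close> enters. All \<open>x\<close> whose
  ball of radius \<open>r1\<close> contains \<open>ball z r\<close> get the same estimate, so a mass
  controls \<open>L g\<close> on a whole neighbourhood when \<open>r < r1\<close>.\<close>

lemma mass_le_L:
  assumes "locint g" "x \<in> \<Omega>" "\<And>y. y \<in> \<Omega> \<Longrightarrow> 0 \<le> g y" "ball z r \<subseteq> ball x r1"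
  shows "c0 * mass z r g \<le> L g x"
proof -
  have "(\<integral>y. c0 * (indicator (ball z r) y * g y) \<partial>M) \<le> (\<integral>y. K x y * g y \<partial>M)"
  proof (rule integral_mono)
    fix y assume "y \<in> space M"
    then have y: "y \<in> \<Omega>" by simp
    have "c0 * indicator (ball z r) y \<le> K x y"
      using K_ge[OF assms(2) y] assms(4) K_nonneg[OF assms(2) y] by (auto simp: indicator_def split: if_splits)
    then show "c0 * (indicator (ball z r) y * g y) \<le> K x y * g y"
      using mult_right_mono[OF _ assms(3)[OF y]] by (metis mult.assoc)
  qed (use assms K_integrable locint_ball in auto)
  then show ?thesis
    by (simp add: nlop_def mass_def)
qed

section \<open>Continuity of the operator up to the boundary\<close>

lemma L_tendsto:
  assumes g: "locint g" and k: "k \<in> borel_measurable M"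
    and lim: "AE y in M. ((\<lambda>x. K x y) \<longlongrightarrow> k y) (at x within \<Omega>)"
  shows "(L g \<longlongrightarrow> (\<integral>y. k y * g y \<partial>M)) (at x within \<Omega>)"
  unfolding tendsto_at_iff_sequentially comp_def
proof (intro allI impI)
  fix s assume s: "\<forall>i::nat. s i \<in> \<Omega> - {x}" "s \<longlonglongrightarrow> x"
  \<comment> \<open>A convergent sequence is bounded, so all kernels \<open>K (s n)\<close> live on
    one ball of radius \<open>R + r0\<close>, and \<open>C0\<close> times the modulus of
    \<open>g\<close> on that ball is the dominating function.\<close>
  obtain R where R: "\<And>n. norm (s n) \<le> R"
    using convergent_imp_bounded[OF s(2)] unfolding bounded_iff by blast
  show "(\<lambda>n. L g (s n)) \<longlonglongrightarrow> (\<integral>y. k y * g y \<partial>M)"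
    unfolding nlop_def
  proof (rule integral_dominated_convergence)
    show "(\<lambda>y. k y * g y) \<in> borel_measurable M"
      using k locint_measurable[OF g] by measurable
    show "(\<lambda>y. K (s n) y * g y) \<in> borel_measurable M" for n
      using K_integrable[OF g] s by blast
    show "integrable M (\<lambda>y. C0 * \<bar>indicator (ball 0 (R + r0)) y * g y\<bar>)"
      using locint_ball[OF g] by simp
    show "AE y in M. (\<lambda>n. K (s n) y * g y) \<longlonglongrightarrow> k y * g y"
      using lim
    proof eventually_elim
      fix y assume "((\<lambda>x. K x y) \<longlongrightarrow> k y) (at x within \<Omega>)"
      then have "(\<lambda>n. K (s n) y) \<longlonglongrightarrow> k y"
        using s unfolding tendsto_at_iff_sequentially comp_def by blast
      then show "(\<lambda>n. K (s n) y * g y) \<longlonglongrightarrow> k y * g y"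
        by (rule tendsto_mult_right)
    qed
    show "AE y in M. norm (K (s n) y * g y) \<le> C0 * \<bar>indicator (ball 0 (R + r0)) y * g y\<bar>" for n
    proof (rule AE_I2)
      fix y assume "y \<in> space M"
      then have y: "y \<in> \<Omega>" and sn: "s n \<in> \<Omega>" using s by auto
      have "ball (s n) r0 \<subseteq> ball 0 (R + r0)"
        using R[of n] by (simp add: ball_subset_ball_iff dist_norm)
      then have "\<bar>K (s n) y\<bar> \<le> C0 * indicator (ball 0 (R + r0)) y"
        using K_le[OF sn y] K_nonneg[OF sn y] C0_pos
        by (cases "y \<in> ball (s n) r0") (auto simp: indicator_def)
      then have "\<bar>K (s n) y\<bar> * \<bar>g y\<bar> \<le> C0 * indicator (ball 0 (R + r0)) y * \<bar>g y\<bar>"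
        by (rule mult_right_mono) simp
      then show "norm (K (s n) y * g y) \<le> C0 * \<bar>indicator (ball 0 (R + r0)) y * g y\<bar>"
        by (simp add: abs_mult)
    qed
  qed
qed

text \<open>For almost every \<open>y\<close>, uniform continuity gives a limit of
  \<open>K x y\<close> at a boundary point. The limit is measurable in \<open>y\<close> because a
  single sequence \<open>q\<close> computes it.\<close>

lemma K_boundary_limit:
  assumes x: "x \<in> closure \<Omega>"
  shows "\<exists>k\<in>borel_measurable M. AE y in M. ((\<lambda>x. K x y) \<longlongrightarrow> k y) (at x within \<Omega>)"
proof -
  have "x islimpt \<Omega>"
    using islimpt_closure_open[OF open_dom refl x] by (simp add: limpt_of_closure)
  then obtain q where q: "\<And>n. q n \<in> \<Omega> - {x}" "q \<longlonglongrightarrow> x"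
    unfolding islimpt_sequential by blast
  have "AE y in M. \<exists>l. ((\<lambda>x. K x y) \<longlongrightarrow> l) (at x within \<Omega>)"
    using K_ucont by eventually_elim (use x uniformly_continuous_on_extension_at_closure in blast)
  then obtain N where N: "N \<in> null_sets M"
      "{y \<in> space M. \<not> (\<exists>l. ((\<lambda>x. K x y) \<longlongrightarrow> l) (at x within \<Omega>))} \<subseteq> N"
    unfolding eventually_ae_filter by blast
  \<comment> \<open>The value 0 on the null set \<open>N\<close> makes the sequence below converge
    at every \<open>y\<close>, as the measurability rule demands.\<close>
  define k where "k y = indicator (\<Omega> - N) y * Lim (at x within \<Omega>) (\<lambda>x. K x y)" for y
  have k: "((\<lambda>x. K x y) \<longlongrightarrow> k y) (at x within \<Omega>)" if "y \<in> \<Omega> - N" for y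
  proof -
    obtain l where l: "((\<lambda>x. K x y) \<longlongrightarrow> l) (at x within \<Omega>)"
      using N(2) \<open>y \<in> \<Omega> - N\<close> by auto
    then show ?thesis
      using \<open>x islimpt \<Omega>\<close> \<open>y \<in> \<Omega> - N\<close> tendsto_Lim[OF _ l] by (simp add: k_def trivial_limit_within)
  qed
  have "k \<in> borel_measurable M"
  proof (rule borel_measurable_LIMSEQ_metric)
    show "(\<lambda>y. indicator (\<Omega> - N) y * K (q n) y) \<in> borel_measurable M" for n
    proof -
      have "\<Omega> - N \<in> sets M"
        using sets.compl_sets[OF null_setsD2[OF N(1)]] by simp
      then show ?thesis
        using K_meas q(1) by simp
    qed
    show "(\<lambda>n. indicator (\<Omega> - N) y * K (q n) y) \<longlonglongrightarrow> k y" if "y \<in> space M" for y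
    proof (cases "y \<in> N")
      case False
      then have "(\<lambda>n. K (q n) y) \<longlonglongrightarrow> k y"
        using k[of y] q that unfolding tendsto_at_iff_sequentially comp_def by auto
      then show ?thesis
        using False that by simp
    qed (simp add: k_def)
  qed
  moreover have "AE y in M. ((\<lambda>x. K x y) \<longlongrightarrow> k y) (at x within \<Omega>)"
    using AE_not_in[OF N(1)] AE_space by eventually_elim (use k in auto)
  ultimately show ?thesis by blast
qed

lemma L_continuous:
  assumes g: "locint g"
  shows "continuous_on \<Omega> (L g)"
  unfolding continuous_on_def
proof
  fix x assume x: "x \<in> \<Omega>"
  have "AE y in M. ((\<lambda>x. K x y) \<longlongrightarrow> K x y) (at x within \<Omega>)"
    using K_ucont
    by eventually_elim (use x in \<open>auto dest: uniformly_continuous_imp_continuous simp: continuous_on_def\<close>)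
  from L_tendsto[OF g K_meas[OF x] this] show "(L g \<longlongrightarrow> L g x) (at x within \<Omega>)"
    by (simp add: nlop_def)
qed

lemma L_extension:
  assumes "locint g"
  obtains h where "continuous_on (closure \<Omega>) h" "\<And>x. x \<in> \<Omega> \<Longrightarrow> h x = L g x"
proof (rule continuous_on_extend_to_closure[OF L_continuous[OF assms]])
  fix x assume "x \<in> closure \<Omega>"
  then show "\<exists>l. (L g \<longlongrightarrow> l) (at x within \<Omega>)"
    using L_tendsto[OF assms] K_boundary_limit by meson
qed (use that in blast)

lemma dom_closure: "x \<in> \<Omega> \<Longrightarrow> x \<in> closure \<Omega>"
  using closure_subset by blast

section \<open>Limits under the integral and finite covers\<close>

lemma L_dominated_convergence:
  assumes "locint h" "\<And>n. locint (g n)" "locint g'" "x \<in> \<Omega>"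
    and "\<And>n y. y \<in> \<Omega> \<Longrightarrow> \<bar>g n y\<bar> \<le> h y"
    and "\<And>y. y \<in> \<Omega> \<Longrightarrow> (\<lambda>n. g n y) \<longlonglongrightarrow> g' y"
  shows "(\<lambda>n. L (g n) x) \<longlonglongrightarrow> L g' x"
  unfolding nlop_def
proof (rule integral_dominated_convergence)
  show "integrable M (\<lambda>y. K x y * h y)"
    using assms by (intro K_integrable)
  show "AE y in M. (\<lambda>n. K x y * g n y) \<longlonglongrightarrow> K x y * g' y"
    using assms(6) by (intro AE_I2 tendsto_mult_left) auto
  show "AE y in M. norm (K x y * g n y) \<le> K x y * h y" for n
    using assms(4,5) K_nonneg by (intro AE_I2) (auto simp: abs_mult intro!: mult_mono)
qed (use K_integrable assms in blast)+

lemma mass_dominated_convergence: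
  assumes "locint h" "\<And>n. locint (g n)" "locint g'"
    and "\<And>n y. y \<in> \<Omega> \<Longrightarrow> \<bar>g n y\<bar> \<le> h y"
    and "\<And>y. y \<in> \<Omega> \<Longrightarrow> (\<lambda>n. g n y) \<longlonglongrightarrow> g' y"
  shows "(\<lambda>n. mass z r (g n)) \<longlonglongrightarrow> mass z r g'"
  unfolding mass_def
proof (rule integral_dominated_convergence)
  show "integrable M (\<lambda>y. indicator (ball z r) y * h y)"
    using assms by (intro locint_ball)
  show "AE y in M. (\<lambda>n. indicator (ball z r) y * g n y) \<longlonglongrightarrow> indicator (ball z r) y * g' y"
    using assms(5) by (intro AE_I2 tendsto_mult_left) auto
  show "AE y in M. norm (indicator (ball z r) y * g n y) \<le> indicator (ball z r) y * h y" for n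
    using assms(4) by (intro AE_I2) (auto simp: abs_mult indicator_def)
qed (use locint_ball assms in blast)+

lemma mass_le_cover:
  assumes "finite Z" "\<Omega> \<inter> ball z R \<subseteq> (\<Union>w\<in>Z. ball w r)"
    and "locint g" "\<And>y. y \<in> \<Omega> \<Longrightarrow> 0 \<le> g y"
  shows "mass z R g \<le> (\<Sum>w\<in>Z. mass w r g)"
proof -
  have "mass z R g \<le> (\<integral>y. (\<Sum>w\<in>Z. indicator (ball w r) y * g y) \<partial>M)"
    unfolding mass_def
  proof (rule integral_mono)
    fix y assume "y \<in> space M"
    then have y: "y \<in> \<Omega>" by simp
    have nonneg: "0 \<le> indicator (ball w r) y * g y" for w
      using assms(4)[OF y] by simp
    show "indicator (ball z R) y * g y \<le> (\<Sum>w\<in>Z. indicator (ball w r) y * g y)"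
    proof (cases "y \<in> ball z R")
      case True
      then obtain w where w: "w \<in> Z" "y \<in> ball w r"
        using assms(2) y by blast
      have "indicator (ball w r) y * g y \<le> (\<Sum>w\<in>Z. indicator (ball w r) y * g y)"
        by (rule member_le_sum) (use w nonneg assms(1) in auto)
      then show ?thesis
        using True w(2) by simp
    qed (simp add: sum_nonneg nonneg)
  qed (intro Bochner_Integration.integrable_sum locint_ball assms)+
  also have "\<dots> = (\<Sum>w\<in>Z. mass w r g)"
    unfolding mass_def by (rule Bochner_Integration.integral_sum) (use assms locint_ball in auto)
  finally show ?thesis .
qed

text \<open>The radius \<open>r\<close> is the same at every centre in \<open>\<Omega>\<close>, so
  these balls also cover the boundary, and compactness leaves finitely many. The constants may
  therefore depend on the centre without any control.\<close>

lemma mass_bound_on_balls: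
  assumes g: "\<And>k. locint (g k)" "\<And>k y. y \<in> \<Omega> \<Longrightarrow> 0 \<le> g k y"
    and bound: "\<And>z. z \<in> \<Omega> \<Longrightarrow> \<exists>C. \<forall>k. mass z r (g k) \<le> C * \<theta> ^ k" and r: "0 < r"
  shows "\<exists>C. \<forall>k. mass 0 R (g k) \<le> C * \<theta> ^ k"
proof -
  have "compact (closure \<Omega> \<inter> cball 0 R)"
    by (simp add: closed_Int_compact)
  moreover have "closure \<Omega> \<inter> cball 0 R \<subseteq> (\<Union>w\<in>\<Omega>. ball w r)"
  proof
    fix y assume "y \<in> closure \<Omega> \<inter> cball 0 R"
    then obtain w where "w \<in> \<Omega>" "dist w y < r"
      using r by (auto simp: closure_approachable)
    then show "y \<in> (\<Union>w\<in>\<Omega>. ball w r)"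
      by auto
  qed
  ultimately obtain Z where Z: "Z \<subseteq> \<Omega>" "finite Z" "closure \<Omega> \<inter> cball 0 R \<subseteq> (\<Union>w\<in>Z. ball w r)"
    using compactE_image[of _ \<Omega> "\<lambda>w. ball w r"] by (metis open_ball)
  obtain C where C: "\<And>w k. w \<in> \<Omega> \<Longrightarrow> mass w r (g k) \<le> C w * \<theta> ^ k"
    using bound by metis
  have "mass 0 R (g k) \<le> (\<Sum>w\<in>Z. C w) * \<theta> ^ k" for k
  proof -
    have "\<Omega> \<inter> ball 0 R \<subseteq> (\<Union>w\<in>Z. ball w r)"
      using Z(3) dom_closure by auto
    then have "mass 0 R (g k) \<le> (\<Sum>w\<in>Z. mass w r (g k))"
      using g Z by (intro mass_le_cover) auto
    also have "\<dots> \<le> (\<Sum>w\<in>Z. C w) * \<theta> ^ k"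
      unfolding sum_distrib_right using C Z(1) by (intro sum_mono) auto
    finally show ?thesis .
  qed
  then show ?thesis by blast
qed

end

section \<open>Positive supersolutions\<close>

text \<open>The lower bound \<open>\<delta>\<close> of the weight serves upper estimates of
  \<open>T\<close>, the upper bound \<open>\<beta>\<close> serves lower ones.\<close>

locale weighted_kernel = nonlocal_kernel \<Omega> K r0 r1 C0 c0
  for \<Omega> :: "'a::euclidean_space set" and K :: "'a \<Rightarrow> 'a \<Rightarrow> real" and r0 r1 C0 c0 :: real +
  fixes b :: "'a \<Rightarrow> real" and \<delta> \<beta> :: real
  assumes b_cont: "continuous_on (closure \<Omega>) b" and \<delta>_pos: "0 < \<delta>"
    and b_ge: "\<And>x. x \<in> closure \<Omega> \<Longrightarrow> \<delta> \<le> b x" and b_le: "\<And>x. x \<in> closure \<Omega> \<Longrightarrow> b x \<le> \<beta>"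
begin

definition T :: "('a \<Rightarrow> real) \<Rightarrow> 'a \<Rightarrow> real" where
  "T g x = L g x / b x"

lemma b_pos: "x \<in> closure \<Omega> \<Longrightarrow> 0 < b x"
  using b_ge[of x] \<delta>_pos by simp

lemma \<beta>_pos: "0 < \<beta>"
  using nonempty_dom b_pos b_le dom_closure by (meson ex_in_conv less_le_trans)

lemma T_extension:
  assumes "locint g"
  obtains h where "continuous_on (closure \<Omega>) h" "\<And>x. x \<in> \<Omega> \<Longrightarrow> h x = T g x"
proof -
  obtain h where h: "continuous_on (closure \<Omega>) h" "\<And>x. x \<in> \<Omega> \<Longrightarrow> h x = L g x"
    using L_extension[OF assms] by blast
  show ?thesis
  proof
    show "continuous_on (closure \<Omega>) (\<lambda>x. h x / b x)"
      using h(1) b_cont b_pos by (intro continuous_on_divide) (auto simp: less_le)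
    show "h x / b x = T g x" if "x \<in> \<Omega>" for x
      using h(2)[OF that] by (simp add: T_def)
  qed
qed

lemma T_continuous: "locint g \<Longrightarrow> continuous_on \<Omega> (T g)"
  by (metis T_extension closure_subset continuous_on_cong continuous_on_subset)

lemma T_locint:
  assumes "locint g"
  shows "locint (T g)"
proof -
  obtain h where h: "continuous_on (closure \<Omega>) h" "\<And>x. x \<in> \<Omega> \<Longrightarrow> h x = T g x"
    using T_extension[OF assms] by blast
  show ?thesis
    using locint_continuous[OF h(1)] continuous_measurable[OF T_continuous[OF assms]]
    by (rule locint_dominated) (simp add: h(2))
qed

lemma T_nonneg: "x \<in> \<Omega> \<Longrightarrow> (\<And>y. y \<in> \<Omega> \<Longrightarrow> 0 \<le> g y) \<Longrightarrow> 0 \<le> T g x"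
  using L_nonneg b_pos dom_closure by (auto simp: T_def intro!: divide_nonneg_pos)

lemma T_mono:
  "locint g \<Longrightarrow> locint h \<Longrightarrow> x \<in> \<Omega> \<Longrightarrow> (\<And>y. y \<in> \<Omega> \<Longrightarrow> g y \<le> h y) \<Longrightarrow> T g x \<le> T h x"
  unfolding T_def using b_pos[OF dom_closure, of x] by (intro divide_right_mono L_mono) auto

lemma T_le_mass:
  assumes "locint g" "x \<in> \<Omega>" "\<And>y. y \<in> \<Omega> \<Longrightarrow> 0 \<le> g y" "ball x r0 \<subseteq> ball z R"
  shows "T g x \<le> C0 / \<delta> * mass z R g"
proof -
  have "T g x \<le> L g x / \<delta>"
    unfolding T_def using b_ge[OF dom_closure[OF assms(2)]] \<delta>_pos L_nonneg[OF assms(2,3)]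
    by (intro divide_left_mono) auto
  also have "\<dots> \<le> C0 * mass z R g / \<delta>"
    using L_le_mass[OF assms] \<delta>_pos by (intro divide_right_mono) auto
  finally show ?thesis by simp
qed

lemma mass_le_T:
  assumes "locint g" "x \<in> \<Omega>" "\<And>y. y \<in> \<Omega> \<Longrightarrow> 0 \<le> g y" "ball z r \<subseteq> ball x r1"
  shows "c0 / \<beta> * mass z r g \<le> T g x"
proof -
  have "c0 * mass z r g / \<beta> \<le> L g x / \<beta>"
    using mass_le_L[OF assms] \<beta>_pos by (intro divide_right_mono) auto
  also have "\<dots> \<le> T g x"
    unfolding T_def
    using b_le[OF dom_closure[OF assms(2)]] b_pos[OF dom_closure[OF assms(2)]] L_nonneg[OF assms(2,3)] \<beta>_pos
    by (intro divide_left_mono) auto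
  finally show ?thesis by simp
qed

section \<open>Iterates and their cut-off versions\<close>

lemma T_iter:
  assumes "locint f" "\<And>y. y \<in> \<Omega> \<Longrightarrow> 0 \<le> f y"
  shows "locint ((T ^^ k) f)" and "y \<in> \<Omega> \<Longrightarrow> 0 \<le> (T ^^ k) f y"
proof (induction k arbitrary: y)
  case (Suc k)
  { case 1 then show ?case using Suc by (simp add: T_locint) }
  { case 2 then show ?case using Suc by (simp add: T_nonneg) }
qed (use assms in simp_all)

text \<open>\<open>T g\<close> need not vanish near the boundary even if \<open>g\<close> has
  compact support; the factor \<open>\<eta>\<close> returns each iterate to \<open>Cc_on\<close>.
  The comparison with the uncut iterate supplies the majorant for removing \<open>\<eta>\<close>
  later.\<close>

lemma cutoff_iter:
  assumes f: "Cc_on \<Omega> f" "locint f" "\<And>y. y \<in> \<Omega> \<Longrightarrow> 0 \<le> f y"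
    and \<eta>: "Cc_on \<Omega> \<eta>" "\<And>y. 0 \<le> \<eta> y" "\<And>y. \<eta> y \<le> 1"
  defines "S \<equiv> \<lambda>g x. \<eta> x * T g x"
  shows "Cc_on \<Omega> ((S ^^ k) f)" and "locint ((S ^^ k) f)"
    and "y \<in> \<Omega> \<Longrightarrow> 0 \<le> (S ^^ k) f y" and "y \<in> \<Omega> \<Longrightarrow> (S ^^ k) f y \<le> (T ^^ k) f y"
proof (induction k arbitrary: y)
  case (Suc k)
  have T_le: "T ((S ^^ k) f) z \<le> T ((T ^^ k) f) z" if "z \<in> \<Omega>" for z
    using Suc T_iter[OF f(2,3)] that by (intro T_mono) auto
  have S_le: "(S ^^ Suc k) f z \<le> T ((S ^^ k) f) z" and S_ge: "0 \<le> (S ^^ Suc k) f z" if "z \<in> \<Omega>" for z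
    using mult_right_mono[OF \<eta>(3)[of z] T_nonneg[OF that Suc(3)]] \<eta>(2)[of z] T_nonneg[OF that Suc(3)]
    by (auto simp: S_def)
  { case 1 then show ?case
      using Cc_on_mult[OF \<eta>(1) T_continuous[OF Suc(2)]] by (simp add: S_def) }
  { case 2 show ?case
    proof (rule locint_dominated[OF T_locint[OF Suc(2)]])
      have "continuous_on \<Omega> (\<lambda>x. \<eta> x * T ((S ^^ k) f) x)"
        using Cc_on_mult[OF \<eta>(1) T_continuous[OF Suc(2)]] by (simp add: Cc_on_def)
      then show "(S ^^ Suc k) f \<in> borel_measurable M"
        using continuous_measurable by (simp add: S_def)
      show "\<bar>(S ^^ Suc k) f z\<bar> \<le> \<bar>T ((S ^^ k) f) z\<bar>" if "z \<in> \<Omega>" for z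
        using S_le[OF that] S_ge[OF that] by simp
    qed }
  { case 3 then show ?case using S_ge by simp }
  { case 4 then show ?case using S_le[OF 4] T_le[OF 4] by simp }
qed (use f in simp_all)

lemma cutoff_iter_tendsto:
  assumes f: "Cc_on \<Omega> f" "locint f" "\<And>y. y \<in> \<Omega> \<Longrightarrow> 0 \<le> f y"
    and \<eta>: "\<And>n. Cc_on \<Omega> (\<eta> n)" "\<And>n y. 0 \<le> \<eta> n y" "\<And>n y. \<eta> n y \<le> 1"
    and \<eta>_lim: "\<And>y. y \<in> \<Omega> \<Longrightarrow> (\<lambda>n. \<eta> n y) \<longlonglongrightarrow> 1"
  shows "y \<in> \<Omega> \<Longrightarrow> (\<lambda>n. ((\<lambda>g x. \<eta> n x * T g x) ^^ k) f y) \<longlonglongrightarrow> (T ^^ k) f y"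
proof (induction k arbitrary: y)
  case (Suc k)
  note S = cutoff_iter[OF f \<eta>]
  have "(\<lambda>n. L (((\<lambda>g x. \<eta> n x * T g x) ^^ k) f) y) \<longlonglongrightarrow> L ((T ^^ k) f) y"
    using Suc T_iter[OF f(2,3)] S by (intro L_dominated_convergence[of "(T ^^ k) f"]) auto
  then have "(\<lambda>n. \<eta> n y * (L (((\<lambda>g x. \<eta> n x * T g x) ^^ k) f) y / b y)) \<longlonglongrightarrow> 1 * (L ((T ^^ k) f) y / b y)"
    using \<eta>_lim[OF Suc(2)] b_pos[OF dom_closure[OF Suc(2)]] by (intro tendsto_intros) auto
  then show ?case
    unfolding T_def[symmetric] by simp
qed simp

text \<open>Add the cut-off iterates with weights \<open>(1 / \<theta>) ^ j\<close>. Under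
  \<open>T\<close> the sum reproduces \<open>\<theta>\<close> times itself up to its first and last
  terms. Where it fails to be a subsolution, the iterate of index \<open>Suc k\<close> must lie
  below \<open>\<theta> ^ Suc k * f\<close>. This puts the point of failure in the bump, and the
  small value there bounds the mass of iterate \<open>k\<close> nearby.\<close>

lemma mass_T_iter_initial:
  assumes \<theta>: "0 < \<theta>" and x: "x \<in> \<Omega>" and \<rho>: "0 < \<rho>" "\<rho> \<le> r1 / 4" "cball x \<rho> \<subseteq> \<Omega>"
    and no_sub: "\<And>\<phi>. Cc_on \<Omega> \<phi> \<Longrightarrow> (\<And>y. y \<in> \<Omega> \<Longrightarrow> 0 \<le> \<phi> y) \<Longrightarrow> \<exists>y\<in>\<Omega>. \<phi> y \<noteq> 0
      \<Longrightarrow> \<exists>y\<in>\<Omega>. L \<phi> y < \<theta> * b y * \<phi> y"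
  defines "f \<equiv> \<lambda>y. max 0 (\<rho> - dist x y)"
  assumes f_locint: "locint f"
  shows "mass x (r1 / 2) ((T ^^ k) f) \<le> \<beta> / c0 * \<theta> * \<rho> * \<theta> ^ k"
proof -
  have f: "Cc_on \<Omega> f" "\<And>y. 0 \<le> f y" "\<And>y. f y \<le> \<rho>" "\<And>y. 0 < f y \<Longrightarrow> dist x y < \<rho>" "f x = \<rho>"
    using Cc_on_bump[OF \<rho>(3)] \<rho>(1) by (auto simp: f_def)
  obtain \<eta> :: "nat \<Rightarrow> 'a \<Rightarrow> real" where
    \<eta>: "\<And>n. Cc_on \<Omega> (\<eta> n)" "\<And>n y. 0 \<le> \<eta> n y" "\<And>n y. \<eta> n y \<le> 1"
    and \<eta>_eq: "\<And>S. compact S \<Longrightarrow> S \<subseteq> \<Omega> \<Longrightarrow> \<exists>N. \<forall>n\<ge>N. \<forall>y\<in>S. \<eta> n y = 1"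
    using Cc_on_cutoffs[OF open_dom] by metis
  define v where "v n j = ((\<lambda>g y. \<eta> n y * T g y) ^^ j) f" for n j
  note v = cutoff_iter[OF f(1) f_locint f(2) \<eta>, folded v_def]
  have v_Suc: "v n (Suc j) y = \<eta> n y * T (v n j) y" for n j y
    by (simp add: v_def)
  obtain N where N: "\<And>n y. n \<ge> N \<Longrightarrow> y \<in> cball x \<rho> \<Longrightarrow> \<eta> n y = 1"
    using \<eta>_eq[OF compact_cball \<rho>(3)] by blast
  have bound: "mass x (r1 / 2) (v n k) \<le> \<beta> / c0 * \<theta> * \<rho> * \<theta> ^ k" if n: "n \<ge> N" for n
  proof -
    define \<phi> where "\<phi> y = (\<Sum>j\<le>k. (1 / \<theta>) ^ j * v n j y)" for y
    have "Cc_on \<Omega> (\<lambda>y. (1 / \<theta>) ^ j * v n j y)" for j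
      using Cc_on_mult[OF v(1)[of n j] continuous_on_const[of _ "(1 / \<theta>) ^ j"]] by (simp add: mult.commute)
    then have "Cc_on \<Omega> \<phi>"
      unfolding \<phi>_def by (intro Cc_on_sum) auto
    moreover have nonneg: "0 \<le> (1 / \<theta>) ^ j * v n j y" if "y \<in> \<Omega>" for j y
      using v(3)[OF that] \<theta> by simp
    then have "0 \<le> \<phi> y" if "y \<in> \<Omega>" for y
      unfolding \<phi>_def using that by (intro sum_nonneg) auto
    moreover have "\<phi> x \<noteq> 0"
    proof -
      have "(1 / \<theta>) ^ 0 * v n 0 x \<le> \<phi> x"
        unfolding \<phi>_def by (rule member_le_sum) (use nonneg[OF x] in auto)
      then show ?thesis
        using f(5) \<rho>(1) by (simp add: v_def)
    qed
    ultimately obtain y where y: "y \<in> \<Omega>" "L \<phi> y < \<theta> * b y * \<phi> y"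
      using no_sub x by blast
    have "L \<phi> y = (\<Sum>j\<le>k. (1 / \<theta>) ^ j * L (v n j) y)"
      unfolding \<phi>_def using v(2) y(1) by (simp add: L_sum locint_cmult L_cmult)
    then have T\<phi>: "L \<phi> y / b y = (\<Sum>j\<le>k. (1 / \<theta>) ^ j * T (v n j) y)"
      by (simp add: T_def sum_divide_distrib)
    \<comment> \<open>Index shift: the shifted sum lacks the term \<open>f\<close> of index 0 and
      has the extra term of index \<open>Suc k\<close>.\<close>
    have "\<theta> * (\<phi> y - f y + (1 / \<theta>) ^ Suc k * v n (Suc k) y)
        = \<theta> * (\<Sum>j\<le>k. (1 / \<theta>) ^ Suc j * v n (Suc j) y)"
      using sum.atMost_Suc_shift[of "\<lambda>j. (1 / \<theta>) ^ j * v n j y" k]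
      by (simp add: \<phi>_def v_def del: funpow.simps(2) power_Suc)
    also have "\<dots> = (\<Sum>j\<le>k. (1 / \<theta>) ^ j * v n (Suc j) y)"
      using \<theta> by (simp add: sum_distrib_left)
    also have "\<dots> \<le> (\<Sum>j\<le>k. (1 / \<theta>) ^ j * T (v n j) y)"
      using \<theta> \<eta>(2,3) T_nonneg[OF y(1) v(3)]
      by (intro sum_mono mult_left_mono) (auto simp: v_Suc intro!: mult_left_le_one_le)
    also have "\<dots> < \<theta> * \<phi> y"
      using y(2) b_pos[OF dom_closure[OF y(1)]] unfolding T\<phi>[symmetric] by (simp add: field_simps)
    finally have "(1 / \<theta>) ^ Suc k * v n (Suc k) y < f y"
      using \<theta> by simp
    then have less: "v n (Suc k) y < \<theta> ^ Suc k * f y"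
      using \<theta> by (simp add: power_divide field_simps)
    \<comment> \<open>The iterate is nonnegative, so \<open>f y = 0\<close> is impossible. This
      locates \<open>y\<close>, about which nothing was known so far.\<close>
    then have "0 < f y"
      using v(3)[OF y(1), of n "Suc k"] \<theta> f(2)[of y] by (cases "f y = 0") (auto simp: less_le)
    then have dist: "dist x y < \<rho>"
      by (rule f(4))
    have "c0 / \<beta> * mass x (r1 / 2) (v n k) \<le> T (v n k) y"
    proof (rule mass_le_T[OF v(2) y(1) v(3)])
      show "ball x (r1 / 2) \<subseteq> ball y r1"
        using dist \<rho>(2) r1_pos by (auto simp: ball_subset_ball_iff)
    qed
    \<comment> \<open>The choice of \<open>N\<close> makes the cutoff equal to 1 at
      \<open>y\<close>.\<close>
    also have "\<dots> = v n (Suc k) y"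
      using N[OF n, of y] dist by (simp add: v_Suc)
    also have "\<dots> \<le> \<theta> ^ Suc k * f y"
      using less by simp
    also have "\<dots> \<le> \<theta> ^ Suc k * \<rho>"
      using f(3) \<theta> by (intro mult_left_mono) auto
    finally show ?thesis
      using c0_pos \<beta>_pos by (simp add: field_simps)
  qed
  have \<eta>_lim: "(\<lambda>n. \<eta> n y) \<longlonglongrightarrow> 1" if "y \<in> \<Omega>" for y
    using \<eta>_eq[of "{y}"] that by (intro tendsto_eventually) (auto simp: eventually_sequentially)
  \<comment> \<open>The uncut iterate is the majorant, and the bound does not depend on
    \<open>n\<close>, so it survives the removal of the cutoff.\<close>
  have "(\<lambda>n. mass x (r1 / 2) (v n k)) \<longlonglongrightarrow> mass x (r1 / 2) ((T ^^ k) f)"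
    using cutoff_iter_tendsto[OF f(1) f_locint f(2) \<eta> \<eta>_lim, folded v_def] v T_iter[OF f_locint f(2)]
    by (intro mass_dominated_convergence[of "(T ^^ k) f"]) auto
  then show ?thesis
    by (rule LIMSEQ_le_const2) (use bound in blast)
qed

text \<open>Each \<open>y\<close> within \<open>r1 / 4\<close> of \<open>z\<close> is within
  \<open>r1 / 2\<close> of \<open>w\<close>, so its ball of radius \<open>r1\<close> contains
  \<open>ball w (r1 / 2)\<close>. Hence \<open>T g\<close> has a constant lower bound on
  \<open>ball z (r1 / 4)\<close>.\<close>

lemma mass_T_propagate:
  assumes "locint g" "\<And>y. y \<in> \<Omega> \<Longrightarrow> 0 \<le> g y" "dist z w < r1 / 4"
  shows "c0 / \<beta> * mass w (r1 / 2) g * mass z (r1 / 4) (\<lambda>y. 1) \<le> mass z (r1 / 2) (T g)"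
proof -
  have "c0 / \<beta> * mass w (r1 / 2) g * mass z (r1 / 4) (\<lambda>y. 1) \<le> mass z (r1 / 4) (T g)"
  proof (rule mass_ge_const[OF T_locint[OF assms(1)]])
    fix y assume y: "y \<in> \<Omega>" "y \<in> ball z (r1 / 4)"
    have "dist w y \<le> dist z w + dist z y"
      by (metis dist_triangle2 dist_commute)
    then have "ball w (r1 / 2) \<subseteq> ball y r1"
      using y(2) assms(3) by (auto simp: ball_subset_ball_iff)
    then show "c0 / \<beta> * mass w (r1 / 2) g \<le> T g y"
      using assms y by (intro mass_le_T) auto
  qed
  also have "\<dots> \<le> mass z (r1 / 2) (T g)"
    using r1_pos assms T_nonneg by (intro mass_ball_mono T_locint) auto
  finally show ?thesis .
qed

text \<open>The mass of iterate \<open>k\<close> near \<open>w\<close> feeds iterate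
  \<open>Suc k\<close> near \<open>z\<close>, so a bound at \<open>z\<close> passes back to its
  neighbour \<open>w\<close>. The shift of the index costs one factor \<open>\<theta>\<close>, which
  goes into the constant; the constant may deteriorate at every step of the chain.\<close>

lemma mass_T_iter_everywhere:
  assumes \<theta>: "0 < \<theta>" and f: "locint f" "\<And>y. y \<in> \<Omega> \<Longrightarrow> 0 \<le> f y" and x: "x \<in> \<Omega>"
    and init: "\<And>k. mass x (r1 / 2) ((T ^^ k) f) \<le> C * \<theta> ^ k" and z: "z \<in> \<Omega>"
  shows "\<exists>C. \<forall>k. mass z (r1 / 2) ((T ^^ k) f) \<le> C * \<theta> ^ k"
proof (rule connected_chain_induct[OF connected_dom x, of _ "r1 / 4"])
  show "\<exists>C. \<forall>k. mass x (r1 / 2) ((T ^^ k) f) \<le> C * \<theta> ^ k"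
    using init by blast
next
  fix z w assume zw: "z \<in> \<Omega>" "w \<in> \<Omega>" "dist z w < r1 / 4"
  assume "\<exists>C. \<forall>k. mass z (r1 / 2) ((T ^^ k) f) \<le> C * \<theta> ^ k"
  then obtain C where C: "\<And>k. mass z (r1 / 2) ((T ^^ k) f) \<le> C * \<theta> ^ k" by blast
  define m where "m = c0 / \<beta> * mass z (r1 / 4) (\<lambda>y. 1)"
  have m: "0 < m"
    using c0_pos \<beta>_pos mass_const_pos[OF zw(1)] r1_pos by (simp add: m_def)
  have "mass w (r1 / 2) ((T ^^ k) f) \<le> C * \<theta> / m * \<theta> ^ k" for k
  proof -
    have "m * mass w (r1 / 2) ((T ^^ k) f) \<le> mass z (r1 / 2) (T ((T ^^ k) f))"
      using mass_T_propagate[OF T_iter[OF f] zw(3)] by (simp add: m_def mult_ac)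
    also have "\<dots> \<le> C * \<theta> ^ Suc k"
      using C[of "Suc k"] by simp
    finally show ?thesis
      using m by (simp add: field_simps)
  qed
  then show "\<exists>C. \<forall>k. mass w (r1 / 2) ((T ^^ k) f) \<le> C * \<theta> ^ k"
    by blast
qed (use r1_pos z in auto)

text \<open>The sum \<open>G\<close> of all iterates satisfies \<open>T G = G - f \<le> G\<close>.
  The function returned is the extension of \<open>T G\<close>: \<open>T_extension\<close> makes it
  continuous on the closure, \<open>mass_le_T\<close> gives it positive lower bounds, and
  monotonicity of \<open>L\<close> keeps it a supersolution.\<close>

lemma positive_supersolution_of_mass_bound:
  assumes \<theta>: "0 < \<theta>" "\<theta> < 1" and f: "locint f" "\<And>y. y \<in> \<Omega> \<Longrightarrow> 0 \<le> f y" "\<And>y. f y \<le> F"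
    and bound: "\<And>R. \<exists>C. \<forall>k. mass 0 R ((T ^^ k) f) \<le> C * \<theta> ^ k"
    and x: "x \<in> \<Omega>" "0 < mass x (r1 / 2) f"
  shows "\<exists>\<phi>. continuous_on (closure \<Omega>) \<phi> \<and> (\<forall>x\<in>closure \<Omega>. 0 < \<phi> x) \<and> (\<forall>x\<in>\<Omega>. L \<phi> x \<le> b x * \<phi> x)"
proof -
  define u where "u k = (T ^^ k) f" for k
  have u: "\<And>k. locint (u k)" "\<And>k y. y \<in> \<Omega> \<Longrightarrow> 0 \<le> u k y"
    using T_iter[OF f(1,2)] by (auto simp: u_def)
  have u_Suc: "u (Suc k) = T (u k)" for k
    by (simp add: u_def)
  \<comment> \<open>One application of \<open>T\<close> turns a bound on masses into a pointwise
    bound. Such bounds begin with \<open>u 1\<close>, which is why \<open>u 0 = f\<close> is split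
    off the series and bounded by \<open>F\<close>.\<close>
  have u_le: "\<exists>C. \<forall>k. \<forall>y\<in>\<Omega>. norm y < R \<longrightarrow> u (Suc k) y \<le> C * \<theta> ^ k" for R
  proof -
    obtain C where C: "\<And>k. mass 0 (R + r0) (u k) \<le> C * \<theta> ^ k"
      using bound[of "R + r0"] by (auto simp: u_def)
    have "u (Suc k) y \<le> C0 / \<delta> * C * \<theta> ^ k" if "y \<in> \<Omega>" "norm y < R" for k y
    proof -
      have "ball y r0 \<subseteq> ball 0 (R + r0)"
        using that(2) by (simp add: ball_subset_ball_iff)
      then have "u (Suc k) y \<le> C0 / \<delta> * mass 0 (R + r0) (u k)"
        unfolding u_Suc using u that by (intro T_le_mass) auto
      also have "\<dots> \<le> C0 / \<delta> * (C * \<theta> ^ k)"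
        using C C0_pos \<delta>_pos by (intro mult_left_mono) auto
      finally show ?thesis by simp
    qed
    then show ?thesis by blast
  qed
  have geo: "summable (\<lambda>k. C * \<theta> ^ k)" "(\<Sum>k. C * \<theta> ^ k) = C / (1 - \<theta>)" for C
    using \<theta> by (auto simp: summable_geometric suminf_mult suminf_geometric)
  have summable_Suc: "summable (\<lambda>k. u (Suc k) y)" if "y \<in> \<Omega>" for y
  proof -
    obtain C where "\<forall>k. \<forall>z\<in>\<Omega>. norm z < norm y + 1 \<longrightarrow> u (Suc k) z \<le> C * \<theta> ^ k"
      using u_le by blast
    then show ?thesis
      using u(2)[OF that] that by (intro summable_comparison_test'[OF geo(1)[of C], of 0]) auto
  qed
  then have summable: "summable (\<lambda>k. u k y)" if "y \<in> \<Omega>" for y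
    using that by (subst summable_Suc_iff[symmetric])
  define G where "G y = (\<Sum>k. u k y)" for y
  have G_split: "G y = f y + (\<Sum>k. u (Suc k) y)" if "y \<in> \<Omega>" for y
    using suminf_split_head[OF summable[OF that]] by (simp add: G_def u_def)
  have f_le_G: "f y \<le> G y" if "y \<in> \<Omega>" for y
    using G_split[OF that] suminf_nonneg[OF summable_Suc[OF that]] u(2)[OF that] by simp
  have G_nonneg: "0 \<le> G y" if "y \<in> \<Omega>" for y
    using f_le_G[OF that] f(2)[OF that] by simp
  have G_locint: "locint G"
  proof (rule locint_bounded)
    show "G \<in> borel_measurable M"
      unfolding G_def using locint_measurable[OF u(1)] by measurable
    fix R
    obtain C where C: "\<forall>k. \<forall>y\<in>\<Omega>. norm y < R \<longrightarrow> u (Suc k) y \<le> C * \<theta> ^ k"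
      using u_le by blast
    have "\<bar>G y\<bar> \<le> F + C / (1 - \<theta>)" if "y \<in> \<Omega>" "norm y < R" for y
    proof -
      have "(\<Sum>k. u (Suc k) y) \<le> (\<Sum>k. C * \<theta> ^ k)"
        using C that by (intro suminf_le summable_Suc geo) auto
      then show ?thesis
        using G_split[OF that(1)] G_nonneg[OF that(1)] f(3)[of y] geo(2)[of C] by simp
    qed
    then show "\<exists>B. \<forall>y\<in>\<Omega>. norm y < R \<longrightarrow> \<bar>G y\<bar> \<le> B" by blast
  qed
  have T_G: "T G y \<le> G y" if y: "y \<in> \<Omega>" for y
  proof -
    \<comment> \<open>By nonnegativity the norms integrate to a multiple of the next iterate, whose
      sum over \<open>k\<close> is finite. This licenses the exchange of sum and integral.\<close>
    have norm_eq: "(\<integral>z. norm (K y z * u k z) \<partial>M) = b y * u (Suc k) y" for k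
    proof -
      have "(\<integral>z. norm (K y z * u k z) \<partial>M) = L (u k) y"
        unfolding nlop_def
        by (rule Bochner_Integration.integral_cong) (use y K_nonneg u(2) in auto)
      then show ?thesis
        using b_pos[OF dom_closure[OF y]] by (simp add: u_Suc T_def)
    qed
    have "L G y = (\<integral>z. (\<Sum>k. K y z * u k z) \<partial>M)"
      unfolding nlop_def G_def
      by (rule Bochner_Integration.integral_cong) (use summable in \<open>auto simp: suminf_mult\<close>)
    also have "\<dots> = (\<Sum>k. \<integral>z. K y z * u k z \<partial>M)"
    proof (rule integral_suminf)
      show "integrable M (\<lambda>z. K y z * u k z)" for k
        using u(1) y by (rule K_integrable)
      show "AE z in M. summable (\<lambda>k. norm (K y z * u k z))"
        using summable u(2) by (intro AE_I2) (auto simp: abs_mult summable_mult)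
      show "summable (\<lambda>k. \<integral>z. norm (K y z * u k z) \<partial>M)"
        unfolding norm_eq using summable_Suc[OF y] by (rule summable_mult)
    qed
    also have "\<dots> = (\<Sum>k. b y * u (Suc k) y)"
      using b_pos[OF dom_closure[OF y]] by (simp add: u_Suc T_def nlop_def)
    also have "\<dots> = b y * (\<Sum>k. u (Suc k) y)"
      using summable_Suc[OF y] by (rule suminf_mult)
    finally have "T G y = (\<Sum>k. u (Suc k) y)"
      using b_pos[OF dom_closure[OF y]] by (simp add: T_def)
    then show ?thesis
      using G_split[OF y] f(2)[OF y] by simp
  qed
  \<comment> \<open>Positivity spreads in the forward direction: positive mass of \<open>G\<close>
    near \<open>z\<close> gives positive mass of \<open>T G\<close>, hence of \<open>G\<close>, near
    \<open>w\<close>.\<close>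
  have mass_G: "0 < mass z (r1 / 2) G" if "z \<in> \<Omega>" for z
  proof (rule connected_chain_induct[OF connected_dom x(1), of _ "r1 / 4"])
    show "0 < mass x (r1 / 2) G"
      using x(2) mass_mono[OF f(1) G_locint f_le_G] by (meson less_le_trans)
  next
    fix z w assume zw: "z \<in> \<Omega>" "w \<in> \<Omega>" "dist z w < r1 / 4" "0 < mass z (r1 / 2) G"
    have "0 < c0 / \<beta> * mass z (r1 / 2) G * mass w (r1 / 4) (\<lambda>y. 1)"
      using zw c0_pos \<beta>_pos r1_pos mass_const_pos[OF zw(2), of "r1 / 4"] by simp
    also have "\<dots> \<le> mass w (r1 / 2) (T G)"
      using G_locint G_nonneg zw(3) by (intro mass_T_propagate) (auto simp: dist_commute)
    also have "\<dots> \<le> mass w (r1 / 2) G"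
      using G_locint T_G by (intro mass_mono T_locint)
    finally show "0 < mass w (r1 / 2) G" .
  qed (use r1_pos that in auto)
  obtain h where h: "continuous_on (closure \<Omega>) h" "\<And>x. x \<in> \<Omega> \<Longrightarrow> h x = T G x"
    using T_extension[OF G_locint] by blast
  have "0 < h x" if x: "x \<in> closure \<Omega>" for x
  proof -
    obtain z where z: "z \<in> \<Omega>" "dist z x < r1 / 4"
      using x r1_pos by (auto simp: closure_approachable dest: spec[of _ "r1 / 4"])
    \<comment> \<open>Limits of positive values could vanish at a boundary point. The constant
      \<open>m\<close> bounds \<open>h\<close> from below at all points of \<open>\<Omega>\<close>
      near \<open>x\<close> and so persists at \<open>x\<close>.\<close>
    define m where "m = c0 / \<beta> * mass z (r1 / 2) G"
    have m: "0 < m"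
      using c0_pos \<beta>_pos mass_G[OF z(1)] by (simp add: m_def)
    have ge: "m \<le> h y" if y: "y \<in> \<Omega>" "dist y x < r1 / 4" for y
    proof -
      have "dist z y \<le> dist z x + dist y x"
        by (rule dist_triangle2)
      then have "ball z (r1 / 2) \<subseteq> ball y r1"
        using z(2) y(2) by (auto simp: ball_subset_ball_iff)
      then show ?thesis
        unfolding m_def h(2)[OF y(1)] using G_locint G_nonneg y(1) by (intro mass_le_T) auto
    qed
    have "m \<le> h x"
    proof (rule ccontr)
      assume "\<not> m \<le> h x"
      then obtain d where d: "0 < d" "\<And>y. y \<in> closure \<Omega> \<Longrightarrow> dist y x < d \<Longrightarrow> dist (h y) (h x) < m - h x"
        using h(1) x unfolding continuous_on_iff by (metis diff_gt_0_iff_gt not_le)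
      obtain y where y: "y \<in> \<Omega>" "dist y x < min d (r1 / 4)"
        using x d(1) r1_pos unfolding closure_approachable by (metis min_less_iff_conj divide_pos_pos zero_less_numeral)
      then have "dist (h y) (h x) < m - h x" "m \<le> h y"
        using d(2)[OF dom_closure] ge by auto
      then show False
        by (simp add: dist_real_def)
    qed
    with m show ?thesis by simp
  qed
  moreover have "L h x \<le> b x * h x" if "x \<in> \<Omega>" for x
  proof -
    have "L h x \<le> L G x"
      using locint_continuous[OF h(1)] G_locint that h(2) T_G by (intro L_mono) auto
    also have "\<dots> = b x * h x"
      using h(2)[OF that] b_pos[OF dom_closure[OF that]] by (simp add: T_def)
    finally show ?thesis .
  qed
  ultimately show ?thesis
    using h(1) by blast
qed

theorem positive_supersolution_or_compact_subsolution:
  assumes \<theta>: "0 < \<theta>" "\<theta> < 1"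
    and no_sub: "\<And>\<phi>. Cc_on \<Omega> \<phi> \<Longrightarrow> (\<And>y. y \<in> \<Omega> \<Longrightarrow> 0 \<le> \<phi> y) \<Longrightarrow> \<exists>y\<in>\<Omega>. \<phi> y \<noteq> 0
      \<Longrightarrow> \<exists>y\<in>\<Omega>. L \<phi> y < \<theta> * b y * \<phi> y"
  shows "\<exists>\<phi>. continuous_on (closure \<Omega>) \<phi> \<and> (\<forall>x\<in>closure \<Omega>. 0 < \<phi> x) \<and> (\<forall>x\<in>\<Omega>. L \<phi> x \<le> b x * \<phi> x)"
proof -
  obtain x where x: "x \<in> \<Omega>"
    using nonempty_dom by blast
  obtain e where e: "0 < e" "cball x e \<subseteq> \<Omega>"
    using open_dom x open_contains_cball by blast
  \<comment> \<open>The bound by \<open>e\<close> keeps the bump inside the domain; the bound by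
    \<open>r1 / 4\<close> makes \<open>ball x (r1 / 2)\<close> lie in the ball of radius
    \<open>r1\<close> about every point of the bump.\<close>
  define \<rho> where "\<rho> = min e (r1 / 4)"
  have \<rho>: "0 < \<rho>" "\<rho> \<le> r1 / 4" "cball x \<rho> \<subseteq> \<Omega>"
    using e r1_pos by (auto simp: \<rho>_def)
  define f where "f y = max 0 (\<rho> - dist x y)" for y
  have f: "locint f" "\<And>y. y \<in> \<Omega> \<Longrightarrow> 0 \<le> f y" "\<And>y. f y \<le> \<rho>"
    using \<rho>(1) unfolding f_def by (auto intro!: locint_continuous continuous_intros)
  have init: "mass x (r1 / 2) ((T ^^ k) f) \<le> \<beta> / c0 * \<theta> * \<rho> * \<theta> ^ k" for k
    unfolding f_def
    by (rule mass_T_iter_initial[OF \<theta>(1) x \<rho> no_sub]) (use f(1) in \<open>auto simp: f_def[abs_def]\<close>)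
  have "\<exists>C. \<forall>k. mass 0 R ((T ^^ k) f) \<le> C * \<theta> ^ k" for R
    using T_iter[OF f(1,2)] mass_T_iter_everywhere[OF \<theta>(1) f(1,2) x init] r1_pos
    by (intro mass_bound_on_balls[of _ "r1 / 2"]) auto
  moreover have "0 < mass x (r1 / 2) f"
  proof -
    have "0 < \<rho> / 2 * mass x (\<rho> / 2) (\<lambda>y. 1)"
      using mass_const_pos[OF x] \<rho>(1) by simp
    also have "\<dots> \<le> mass x (\<rho> / 2) f"
      using f(1) by (intro mass_ge_const) (auto simp: f_def max_def)
    also have "\<dots> \<le> mass x (r1 / 2) f"
      using f \<rho> by (intro mass_ball_mono) auto
    finally show ?thesis .
  qed
  ultimately show ?thesis
    using positive_supersolution_of_mass_bound[OF \<theta> f _ x] by blast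
qed

end

section \<open>Comparison of the eigenvalues without symmetry\<close>

lemma lambda_p''_le_ereal:
  assumes "Cc_on \<Omega> \<phi>" "\<And>x. x \<in> \<Omega> \<Longrightarrow> 0 \<le> \<phi> x" "\<exists>x\<in>\<Omega>. \<phi> x \<noteq> 0"
    "\<And>x. x \<in> \<Omega> \<Longrightarrow> 0 \<le> nlop \<Omega> K \<phi> x + (a x + l) * \<phi> x"
  shows "lambda_p'' \<Omega> K a \<le> ereal l"
  unfolding lambda_p''_def by (rule Inf_lower) (use assms in blast)

lemma ereal_le_lambda_p:
  assumes "continuous_on (closure \<Omega>) \<phi>" "\<And>x. x \<in> closure \<Omega> \<Longrightarrow> 0 < \<phi> x"
    "\<And>x. x \<in> \<Omega> \<Longrightarrow> nlop \<Omega> K \<phi> x + a x * \<phi> x + l * \<phi> x \<le> 0"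
  shows "ereal l \<le> lambda_p \<Omega> K a"
  unfolding lambda_p_def by (rule Sup_upper) (use assms in blast)

lemma lambda_p'_le_lambda_p'':
  fixes \<Omega> :: "'a::euclidean_space set"
  shows "lambda_p' \<Omega> K a \<le> lambda_p'' \<Omega> K a"
proof -
  have "continuous_on \<Omega> \<phi> \<and> bounded (\<phi> ` \<Omega>)" if "Cc_on \<Omega> \<phi>" for \<phi> :: "'a \<Rightarrow> real"
    using that Cc_on_bounded by (simp add: Cc_on_def)
  then show ?thesis
    unfolding lambda_p'_def lambda_p''_def by (intro Inf_superset_mono) blast
qed

context nonlocal_kernel
begin

text \<open>A bump supported where \<open>a + l > 0\<close> is a subsolution, since \<open>L\<close>
  preserves nonnegativity. Contrapositively, \<open>a + l \<le> 0\<close> for every \<open>l\<close>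
  below \<open>lambda_p''\<close>; this bounds the weight away from 0.\<close>

lemma lambda_p''_le_neg:
  assumes a: "continuous_on \<Omega> a" and x: "x \<in> \<Omega>" "0 < a x + l"
  shows "lambda_p'' \<Omega> K a \<le> ereal l"
proof -
  have "open (a -` {- l<..} \<inter> \<Omega>)"
    using a unfolding continuous_on_open_vimage[OF open_dom] by simp
  also have "a -` {- l<..} \<inter> \<Omega> = {y \<in> \<Omega>. 0 < a y + l}"
    by auto
  finally have "open {y \<in> \<Omega>. 0 < a y + l}" .
  then obtain e where e: "0 < e" "cball x e \<subseteq> {y \<in> \<Omega>. 0 < a y + l}"
    using x open_contains_cball_eq[of "{y \<in> \<Omega>. 0 < a y + l}"] by blast
  define f where "f y = max 0 (e - dist x y)" for y
  have f: "0 \<le> f y" "f y \<noteq> 0 \<Longrightarrow> y \<in> cball x e" for y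
    by (auto simp: f_def)
  show ?thesis
  proof (rule lambda_p''_le_ereal)
    show "Cc_on \<Omega> f"
      unfolding f_def using e(2) by (intro Cc_on_bump) auto
    show "\<exists>x\<in>\<Omega>. f x \<noteq> 0"
      using x(1) e(1) by (intro bexI[of _ x]) (auto simp: f_def)
    show "0 \<le> L f y + (a y + l) * f y" if "y \<in> \<Omega>" for y
    proof -
      have "0 \<le> (a y + l) * f y"
        using f[of y] e(2) by (cases "f y = 0") (auto intro!: mult_nonneg_nonneg)
      then show ?thesis
        using L_nonneg[OF that, of f] f(1) by simp
    qed
  qed (rule f)
qed

lemma lambda_p''_le_lambda_p:
  assumes a: "continuous_on (closure \<Omega>) a" "bounded (a ` \<Omega>)"
  shows "lambda_p'' \<Omega> K a \<le> lambda_p \<Omega> K a"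
proof (rule ccontr)
  assume "\<not> lambda_p'' \<Omega> K a \<le> lambda_p \<Omega> K a"
  \<comment> \<open>Two numbers go into the gap: \<open>l\<close> rules out compactly supported
    subsolutions, and the smaller \<open>l'\<close> will contradict the definition of
    \<open>lambda_p\<close>. Their difference gives both the lower bound of \<open>b\<close> and
    \<open>\<theta> < 1\<close>.\<close>
  then obtain l where "lambda_p \<Omega> K a < ereal l" and l_less: "ereal l < lambda_p'' \<Omega> K a"
    using ereal_dense2[of "lambda_p \<Omega> K a" "lambda_p'' \<Omega> K a"] by (auto simp: not_le)
  then obtain l' where l': "lambda_p \<Omega> K a < ereal l'" "l' < l"
    using ereal_dense2[of "lambda_p \<Omega> K a" "ereal l"] by auto
  note l = l' l_less
  have a_dom: "continuous_on \<Omega> a"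
    using a(1) closure_subset by (rule continuous_on_subset)
  have "a x + l \<le> 0" if "x \<in> \<Omega>" for x
  proof (rule ccontr)
    assume "\<not> a x + l \<le> 0"
    then have "lambda_p'' \<Omega> K a \<le> ereal l"
      using a_dom that by (intro lambda_p''_le_neg[of a x l]) auto
    with l(3) show False by simp
  qed
  then have al: "a x + l \<le> 0" if "x \<in> closure \<Omega>" for x
  proof -
    have "continuous_on (closure \<Omega>) (\<lambda>x. a x + l)"
      using a(1) by (intro continuous_intros)
    then show ?thesis
      using that \<open>\<And>x. x \<in> \<Omega> \<Longrightarrow> a x + l \<le> 0\<close> by (rule continuous_le_on_closure)
  qed
  obtain A where "\<And>x. x \<in> \<Omega> \<Longrightarrow> \<bar>a x\<bar> \<le> A"
    using a(2) by (auto simp: bounded_iff)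
  then have A: "- A \<le> a x" if "x \<in> \<Omega>" for x
    using that by (simp add: abs_le_iff minus_le_iff)
  have A': "- A \<le> a x" if "x \<in> closure \<Omega>" for x
    using a(1) that A by (rule continuous_ge_on_closure)
  define \<delta> where "\<delta> = l - l'"
  \<comment> \<open>The modulus bounds \<open>b\<close>, because \<open>- A \<le> a\<close>; adding
    \<open>\<delta> + 1\<close> ensures \<open>\<delta> < \<beta>\<close>, hence
    \<open>0 < \<theta>\<close>.\<close>
  define \<beta> where "\<beta> = \<bar>A - l'\<bar> + \<delta> + 1"
  define \<theta> where "\<theta> = 1 - \<delta> / \<beta>"
  define b where "b x = - (a x + l')" for x
  have \<beta>: "0 < \<delta>" "\<delta> < \<beta>"
    using l(2) by (auto simp: \<delta>_def \<beta>_def)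
  then have \<theta>: "0 < \<theta>" "\<theta> < 1"
    by (auto simp: \<theta>_def)
  interpret weighted_kernel \<Omega> K r0 r1 C0 c0 b \<delta> \<beta>
  proof
    show "continuous_on (closure \<Omega>) b"
      unfolding b_def using a(1) by (intro continuous_intros)
    show "\<delta> \<le> b x" "b x \<le> \<beta>" if "x \<in> closure \<Omega>" for x
      using al[OF that] A'[OF that] \<beta>(1) by (auto simp: b_def \<delta>_def \<beta>_def)
  qed (rule \<beta>(1))
  have "\<exists>\<phi>. continuous_on (closure \<Omega>) \<phi> \<and> (\<forall>x\<in>closure \<Omega>. 0 < \<phi> x) \<and> (\<forall>x\<in>\<Omega>. L \<phi> x \<le> b x * \<phi> x)"
  proof (rule positive_supersolution_or_compact_subsolution[OF \<theta>])
    fix \<phi> assume \<phi>: "Cc_on \<Omega> \<phi>" "\<And>y. y \<in> \<Omega> \<Longrightarrow> 0 \<le> \<phi> y" "\<exists>y\<in>\<Omega>. \<phi> y \<noteq> 0"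
    have "\<not> (\<forall>y\<in>\<Omega>. 0 \<le> L \<phi> y + (a y + l) * \<phi> y)"
    proof
      assume "\<forall>y\<in>\<Omega>. 0 \<le> L \<phi> y + (a y + l) * \<phi> y"
      then have "lambda_p'' \<Omega> K a \<le> ereal l"
        by (intro lambda_p''_le_ereal[OF \<phi>]) auto
      with l(3) show False by simp
    qed
    then obtain y where y: "y \<in> \<Omega>" "L \<phi> y + (a y + l) * \<phi> y < 0"
      by (auto simp: not_le)
    \<comment> \<open>Equivalent to \<open>(1 - \<theta>) * b y \<le> \<delta>\<close>, which holds
      since \<open>1 - \<theta> = \<delta> / \<beta>\<close> and
      \<open>b y \<le> \<beta>\<close>.\<close>
    have "b y - \<delta> \<le> \<theta> * b y"
      using b_le[OF dom_closure[OF y(1)]] \<beta> by (simp add: \<theta>_def field_simps)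
    then have "(b y - \<delta>) * \<phi> y \<le> \<theta> * b y * \<phi> y"
      using \<phi>(2)[OF y(1)] by (rule mult_right_mono)
    moreover have "(a y + l) * \<phi> y = - ((b y - \<delta>) * \<phi> y)"
      by (simp add: b_def \<delta>_def algebra_simps)
    ultimately show "\<exists>y\<in>\<Omega>. L \<phi> y < \<theta> * b y * \<phi> y"
      using y by (intro bexI[of _ y]) auto
  qed
  then obtain \<phi> where \<phi>: "continuous_on (closure \<Omega>) \<phi>" "\<And>x. x \<in> closure \<Omega> \<Longrightarrow> 0 < \<phi> x"
      "\<And>x. x \<in> \<Omega> \<Longrightarrow> L \<phi> x \<le> b x * \<phi> x" by blast
  have "ereal l' \<le> lambda_p \<Omega> K a"
  proof (rule ereal_le_lambda_p[OF \<phi>(1,2)])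
    show "L \<phi> x + a x * \<phi> x + l' * \<phi> x \<le> 0" if "x \<in> \<Omega>" for x
      using \<phi>(3)[OF that] by (simp add: b_def algebra_simps)
  qed
  with l(1) show False by simp
qed

end

section \<open>The variational eigenvalue\<close>

text \<open>If every such radius failed, \<open>I\<close> would grow at least like
  \<open>q ^ n\<close> along the radii \<open>R0 + n * s\<close>, faster than any
  polynomial.\<close>

lemma polynomial_growth_ratio:
  fixes I :: "real \<Rightarrow> real"
  assumes bound: "\<And>R. 0 < R \<Longrightarrow> I R \<le> D * R ^ N" and D: "0 \<le> D" and N: "0 < N"
    and R: "0 < R0" "0 < I R0" and s: "0 < s" and q: "1 < q"
  shows "\<exists>R\<ge>R0. 0 < I R \<and> I (R + s) \<le> q * I R"
proof (rule ccontr)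
  assume no: "\<not> (\<exists>R\<ge>R0. 0 < I R \<and> I (R + s) \<le> q * I R)"
  have grow: "q ^ n * I R0 \<le> I (R0 + real n * s) \<and> 0 < I (R0 + real n * s)" for n
  proof (induction n)
    case (Suc n)
    have "q * I (R0 + real n * s) < I (R0 + real n * s + s)"
      using no Suc s by (metis add_increasing2 le_add_same_cancel1 less_imp_le mult_nonneg_nonneg not_le of_nat_0_le_iff)
    moreover have "q ^ Suc n * I R0 \<le> q * I (R0 + real n * s)" "0 < q * I (R0 + real n * s)"
      using Suc q by (auto simp: mult.assoc)
    moreover have "R0 + real (Suc n) * s = R0 + real n * s + s"
      by (simp add: algebra_simps)
    ultimately show ?case
      by (metis less_le_trans less_imp_le order_trans)
  qed (use R in simp)
  \<comment> \<open>The root moves the factor \<open>q ^ n\<close> inside the power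
    \<open>N\<close>, leaving a linear function of \<open>n\<close> over \<open>p ^ n\<close>, which
    tends to 0.\<close>
  define p where "p = root N q"
  have p: "1 < p" "p ^ N = q"
    using q N by (auto simp: p_def)
  have "(\<lambda>n. R0 * inverse p ^ n + s * (real n / p ^ n)) \<longlonglongrightarrow> R0 * 0 + s * 0"
    using p(1) by (intro tendsto_intros LIMSEQ_power_zero lim_n_over_pown) (auto simp: inverse_less_1_iff)
  then have "(\<lambda>n. D * (R0 * inverse p ^ n + s * (real n / p ^ n)) ^ N) \<longlonglongrightarrow> D * 0 ^ N"
    by (intro tendsto_intros) simp
  then have "(\<lambda>n. D * (R0 * inverse p ^ n + s * (real n / p ^ n)) ^ N) \<longlonglongrightarrow> 0"
    using N by (simp add: zero_power)
  moreover have "I R0 \<le> D * (R0 * inverse p ^ n + s * (real n / p ^ n)) ^ N" for n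
  proof -
    have "q ^ n * I R0 \<le> D * (R0 + real n * s) ^ N"
      using grow[of n] bound[of "R0 + real n * s"] R(1) s
      by (meson add_pos_nonneg less_imp_le mult_nonneg_nonneg of_nat_0_le_iff order_trans)
    moreover have "R0 * inverse p ^ n + s * (real n / p ^ n) = (R0 + real n * s) / p ^ n"
      using p(1) by (simp add: field_simps)
    moreover have "(p ^ n) ^ N = q ^ n"
      using p(2) by (metis power_mult mult.commute)
    ultimately show ?thesis
      using q by (simp add: power_divide field_simps)
  qed
  ultimately have "I R0 \<le> 0"
    by (intro LIMSEQ_le_const) auto
  with R(2) show False by simp
qed

context nonlocal_kernel
begin

section \<open>Square-integrable functions and the quadratic form\<close>

lemma pair_sigma_finite_M: "pair_sigma_finite M M"
  using sigma_finite_M by (simp add: pair_sigma_finite_def)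

lemma ident_measurable: "(\<lambda>x. x) \<in> M \<rightarrow>\<^sub>M borel"
  by (intro measurable_restrict_space1 measurable_completion) simp

lemma mass_const_le: "mass z r (\<lambda>y. 1) \<le> measure lborel (ball (0::'a) r)"
proof -
  have "mass z r (\<lambda>y. 1) = measure M (ball z r \<inter> space M)"
    unfolding mass_def mult_1_right by (rule Bochner_Integration.integral_indicator)
  also have "\<dots> = measure lebesgue (ball z r \<inter> \<Omega>)"
    using sets_dom by (subst measure_restrict_space) auto
  also have "\<dots> \<le> measure lebesgue (ball z r)"
    using sets_dom by (intro measure_mono_fmeasurable) auto
  also have "\<dots> = measure lborel (ball (0::'a) r)"
    by (cases "0 \<le> r") (simp_all add: ball_empty content_ball_conv_unit_ball[of r z] content_ball_conv_unit_ball[of r 0])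
  finally show ?thesis .
qed

lemma ball_indicator_joint_measurable:
  "(\<lambda>p. indicator (ball (fst p) r) (snd p) :: real) \<in> borel_measurable (M \<Otimes>\<^sub>M M)"
proof -
  have [measurable]: "fst \<in> M \<Otimes>\<^sub>M M \<rightarrow>\<^sub>M borel" "snd \<in> M \<Otimes>\<^sub>M M \<rightarrow>\<^sub>M borel"
    using measurable_compose[OF measurable_fst ident_measurable]
      measurable_compose[OF measurable_snd ident_measurable] by auto
  have "(\<lambda>p. if dist (fst p) (snd p) < r then 1 else 0 :: real) \<in> borel_measurable (M \<Otimes>\<^sub>M M)"
    by measurable
  then show ?thesis
    by (simp add: indicator_def mem_ball)
qed

text \<open>Exchanging the integrals, each value \<open>g y\<close> is counted with the volume of
  the part of the domain within \<open>r\<close> of \<open>y\<close>, at most the volume of a full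
  ball.\<close>

lemma mass_integral:
  assumes g: "integrable M g"
  shows "integrable M (\<lambda>x. mass x r g)"
    and "(\<And>y. y \<in> \<Omega> \<Longrightarrow> 0 \<le> g y) \<Longrightarrow> (\<integral>x. mass x r g \<partial>M) \<le> measure lborel (ball (0::'a) r) * (\<integral>x. g x \<partial>M)"
proof -
  interpret pair_sigma_finite M M by (rule pair_sigma_finite_M)
  note [measurable] = ball_indicator_joint_measurable
  have [measurable]: "g \<in> borel_measurable M"
    using g by simp
  have mass_meas: "(\<lambda>y. mass y r (\<lambda>x. 1)) \<in> borel_measurable M"
    unfolding mass_def by (intro M1.borel_measurable_lebesgue_integral) (simp add: split_beta' ball_indicator_joint_measurable)
  have mass_bd: "\<bar>mass y r (\<lambda>x. 1)\<bar> \<le> measure lborel (ball (0::'a) r)" for y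
    using mass_const_le[of y r] mass_nonneg[of "\<lambda>x. 1" y r] by simp
  have int1: "integrable M (\<lambda>y. g y * mass y r (\<lambda>x. 1))"
  proof (rule Bochner_Integration.integrable_bound)
    show "integrable M (\<lambda>y. measure lborel (ball (0::'a) r) * g y)"
      using g by simp
    show "AE y in M. norm (g y * mass y r (\<lambda>x. 1)) \<le> norm (measure lborel (ball (0::'a) r) * g y)"
      using mass_bd by (intro AE_I2) (auto simp: abs_mult mult.commute intro!: mult_left_mono)
  qed (use mass_meas in measurable)
  \<comment> \<open>With \<open>g\<close> in the outer variable the inner integral is the modulus of
    \<open>g\<close> times a bounded volume. The swap of variables relies on the symmetry of the
    distance.\<close>
  have "integrable (M \<Otimes>\<^sub>M M) (\<lambda>p. indicator (ball (fst p) r) (snd p) * g (fst p))"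
  proof (rule Fubini_integrable)
    have "integrable M (\<lambda>y. norm (g y * mass y r (\<lambda>x. 1)))"
      using int1 by (rule integrable_norm)
    then show "integrable M (\<lambda>y. \<integral>x. norm (indicator (ball (fst (y, x)) r) (snd (y, x)) * g (fst (y, x))) \<partial>M)"
      using mass_nonneg[of "\<lambda>x. 1"] by (simp add: abs_mult mass_def mult.commute)
    show "AE y in M. integrable M (\<lambda>x. indicator (ball (fst (y, x)) r) (snd (y, x)) * g (fst (y, x)))"
      using integrable_indicator_ball by simp
  qed measurable
  from integrable_product_swap[OF this]
  have F: "integrable (M \<Otimes>\<^sub>M M) (\<lambda>(x, y). indicator (ball x r) y * g y)"
    by (simp add: split_beta' indicator_def dist_commute)
  from integrable_fst[OF F] show "integrable M (\<lambda>x. mass x r g)"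
    by (simp add: mass_def)
  assume nonneg: "\<And>y. y \<in> \<Omega> \<Longrightarrow> 0 \<le> g y"
  have "(\<integral>x. mass x r g \<partial>M) = (\<integral>y. (\<integral>x. indicator (ball x r) y * g y \<partial>M) \<partial>M)"
    using Fubini_integral[OF F] by (simp add: mass_def)
  also have "\<dots> = (\<integral>y. g y * mass y r (\<lambda>x. 1) \<partial>M)"
    by (simp add: mass_def indicator_def dist_commute mult.commute)
  also have "\<dots> \<le> (\<integral>y. measure lborel (ball (0::'a) r) * g y \<partial>M)"
    using mass_bd nonneg int1 g
    by (intro integral_mono) (auto simp: mult.commute abs_le_iff intro!: mult_left_mono)
  finally show "(\<integral>x. mass x r g \<partial>M) \<le> measure lborel (ball (0::'a) r) * (\<integral>x. g x \<partial>M)"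
    by simp
qed

lemma integrable_locint:
  assumes "integrable M g"
  shows "locint g"
  unfolding locint_def
proof (intro conjI allI)
  fix R
  show "integrable M (\<lambda>y. indicator (ball 0 R) y * g y)"
  proof (rule Bochner_Integration.integrable_bound[OF assms])
    show "(\<lambda>y. indicator (ball 0 R) y * g y) \<in> borel_measurable M"
      using borel_measurable_integrable[OF assms] by measurable
  qed (auto simp: indicator_def intro!: AE_I2)
qed (use assms in simp)

lemma L2_locint:
  assumes "L2_on \<Omega> v"
  shows "locint v"
proof (rule locint_dominated)
  show "locint (\<lambda>y. 1 + (v y)\<^sup>2)"
    using assms by (intro locint_add locint_const integrable_locint) (simp add: L2_on_def)
  have "\<bar>t\<bar> \<le> 1 + t\<^sup>2" for t :: real
    using zero_le_power2[of "\<bar>t\<bar> - 1 / 2"] by (simp add: power2_diff power_divide)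
  then show "\<bar>v y\<bar> \<le> \<bar>1 + (v y)\<^sup>2\<bar>" for y
    by (meson abs_ge_self order_trans)
qed (use assms in \<open>simp add: L2_on_def\<close>)

lemma L2_on_indicator_ball:
  assumes "f \<in> borel_measurable M" "locint (\<lambda>y. (f y)\<^sup>2)"
  shows "L2_on \<Omega> (\<lambda>y. indicator (ball z r) y * f y)"
proof -
  have "(indicator (ball z r) y * f y)\<^sup>2 = indicator (ball z r) y * (f y)\<^sup>2" for y
    by (simp add: indicator_def)
  then show ?thesis
    unfolding L2_on_def using borel_measurable_times[OF indicator_ball_measurable assms(1)] locint_ball[OF assms(2)]
    by simp
qed

text \<open>Young's inequality with a weight \<open>t\<close>, a form of the Schur test. The kernel
  is replaced by its indicator bound before integrating in \<open>x\<close>, so Fubini is applied to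
  ball indicators only. The free \<open>t\<close> balances a small norm of \<open>v\<close> against
  the norm of \<open>u\<close>.\<close>

lemma L_quadratic_bound:
  assumes u: "L2_on \<Omega> u" and v: "L2_on \<Omega> v" and t: "0 < t"
  shows "integrable M (\<lambda>x. L v x * u x)"
    and "\<bar>\<integral>x. L v x * u x \<partial>M\<bar> \<le> C0 * measure lborel (ball (0::'a) r0) / 2 * (t * (\<integral>x. (u x)\<^sup>2 \<partial>M) + (\<integral>x. (v x)\<^sup>2 \<partial>M) / t)"
proof -
  define V where "V = measure lborel (ball (0::'a) r0)"
  define w where "w x = C0 / 2 * (t * V * (u x)\<^sup>2 + mass x r0 (\<lambda>y. (v y)\<^sup>2) / t)" for x
  have u2: "integrable M (\<lambda>y. (u y)\<^sup>2)" and v2: "integrable M (\<lambda>y. (v y)\<^sup>2)"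
    using u v by (auto simp: L2_on_def)
  have w: "integrable M w"
    unfolding w_def using u2 mass_integral(1)[OF v2] by simp
  have le: "\<bar>L v x * u x\<bar> \<le> w x" if x: "x \<in> \<Omega>" for x
  proof -
    have "\<bar>L v x\<bar> \<le> (\<integral>y. \<bar>K x y * v y\<bar> \<partial>M)"
      unfolding nlop_def by (rule integral_abs_bound)
    then have "\<bar>L v x * u x\<bar> \<le> (\<integral>y. \<bar>K x y * v y\<bar> * \<bar>u x\<bar> \<partial>M)"
      by (simp add: abs_mult mult_right_mono)
    also have "\<dots> \<le> (\<integral>y. C0 / 2 * (t * (u x)\<^sup>2 * indicator (ball x r0) y + indicator (ball x r0) y * (v y)\<^sup>2 / t) \<partial>M)"
    proof (rule integral_mono)
      show "integrable M (\<lambda>y. \<bar>K x y * v y\<bar> * \<bar>u x\<bar>)"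
        using K_integrable[OF L2_locint[OF v] x] by simp
      show "integrable M (\<lambda>y. C0 / 2 * (t * (u x)\<^sup>2 * indicator (ball x r0) y + indicator (ball x r0) y * (v y)\<^sup>2 / t))"
        using integrable_indicator_ball[of x r0] locint_ball[OF integrable_locint[OF v2], of x r0]
        by (intro integrable_mult_right Bochner_Integration.integrable_add integrable_divide_zero) auto
      fix y assume "y \<in> space M"
      then have y: "y \<in> \<Omega>" by simp
      have "2 * (\<bar>v y\<bar> * \<bar>u x\<bar>) \<le> t * (u x)\<^sup>2 + (v y)\<^sup>2 / t"
      proof -
        have "0 \<le> (t * \<bar>u x\<bar> - \<bar>v y\<bar>)\<^sup>2 / t"
          using t by simp
        also have "\<dots> = t * (u x)\<^sup>2 + (v y)\<^sup>2 / t - 2 * (\<bar>v y\<bar> * \<bar>u x\<bar>)"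
          using t by (simp add: power2_eq_square field_simps)
        finally show ?thesis by simp
      qed
      then have "K x y * (\<bar>v y\<bar> * \<bar>u x\<bar>) \<le> K x y * ((t * (u x)\<^sup>2 + (v y)\<^sup>2 / t) / 2)"
        using K_nonneg[OF x y] by (intro mult_left_mono) auto
      also have "\<dots> \<le> (C0 * indicator (ball x r0) y) * ((t * (u x)\<^sup>2 + (v y)\<^sup>2 / t) / 2)"
        using K_le[OF x y] t by (intro mult_right_mono) auto
      finally show "\<bar>K x y * v y\<bar> * \<bar>u x\<bar> \<le> C0 / 2 * (t * (u x)\<^sup>2 * indicator (ball x r0) y + indicator (ball x r0) y * (v y)\<^sup>2 / t)"
        using K_nonneg[OF x y] by (simp add: abs_mult algebra_simps)
    qed
    also have "\<dots> = C0 / 2 * (t * (u x)\<^sup>2 * mass x r0 (\<lambda>y. 1) + mass x r0 (\<lambda>y. (v y)\<^sup>2) / t)"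
      using integrable_indicator_ball[of x r0] locint_ball[OF integrable_locint[OF v2], of x r0]
      by (simp add: mass_def Bochner_Integration.integral_add)
    also have "\<dots> \<le> C0 / 2 * (t * (u x)\<^sup>2 * V + mass x r0 (\<lambda>y. (v y)\<^sup>2) / t)"
      unfolding V_def using mass_const_le C0_pos t by (intro mult_left_mono add_right_mono) auto
    also have "\<dots> = w x"
      by (simp add: w_def mult_ac)
    finally show ?thesis .
  qed
  have "(\<lambda>x. L v x * u x) \<in> borel_measurable M"
    using continuous_measurable[OF L_continuous[OF L2_locint[OF v]]] u by (auto simp: L2_on_def)
  then show int: "integrable M (\<lambda>x. L v x * u x)"
    using le by (intro Bochner_Integration.integrable_bound[OF w] AE_I2) (auto simp: order_trans[OF _ abs_ge_self])
  have "\<bar>\<integral>x. L v x * u x \<partial>M\<bar> \<le> (\<integral>x. \<bar>L v x * u x\<bar> \<partial>M)"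
    by (rule integral_abs_bound)
  also have "\<dots> \<le> (\<integral>x. w x \<partial>M)"
    using int w le by (intro integral_mono) auto
  also have "\<dots> = C0 / 2 * (t * V * (\<integral>x. (u x)\<^sup>2 \<partial>M) + (\<integral>x. mass x r0 (\<lambda>y. (v y)\<^sup>2) \<partial>M) / t)"
    unfolding w_def using u2 mass_integral(1)[OF v2, of r0] by (simp add: Bochner_Integration.integral_add)
  also have "\<dots> \<le> C0 / 2 * (t * V * (\<integral>x. (u x)\<^sup>2 \<partial>M) + V * (\<integral>x. (v x)\<^sup>2 \<partial>M) / t)"
    using mass_integral(2)[OF v2, of r0] C0_pos t
    by (intro mult_left_mono add_left_mono divide_right_mono) (auto simp: V_def)
  finally show "\<bar>\<integral>x. L v x * u x \<partial>M\<bar> \<le> C0 * measure lborel (ball (0::'a) r0) / 2 * (t * (\<integral>x. (u x)\<^sup>2 \<partial>M) + (\<integral>x. (v x)\<^sup>2 \<partial>M) / t)"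
    by (simp add: V_def algebra_simps)
qed

section \<open>Truncated subsolutions as test functions\<close>

lemma lambda_v_le_ereal:
  assumes "L2_on \<Omega> \<phi>" "0 < (\<integral>x. (\<phi> x)\<^sup>2 \<partial>M)"
    and "- l * (\<integral>x. (\<phi> x)\<^sup>2 \<partial>M) \<le> (\<integral>x. (L \<phi> x + a x * \<phi> x) * \<phi> x \<partial>M)"
  shows "lambda_v \<Omega> K a \<le> ereal l"
proof -
  have "\<not> (AE x in M. \<phi> x = 0)"
  proof
    assume "AE x in M. \<phi> x = 0"
    then have "AE x in M. (\<phi> x)\<^sup>2 = 0" by eventually_elim simp
    then have "(\<integral>x. (\<phi> x)\<^sup>2 \<partial>M) = 0" by (rule integral_eq_zero_AE)
    with assms(2) show False by simp
  qed
  then have "lambda_v \<Omega> K a \<le> ereal (- (\<integral>x. (L \<phi> x + a x * \<phi> x) * \<phi> x \<partial>M) / (\<integral>x. (\<phi> x)\<^sup>2 \<partial>M))"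
    unfolding lambda_v_def using assms(1) by (intro Inf_lower) blast
  also have "\<dots> \<le> ereal l"
    using assms(2,3) by (simp add: field_simps)
  finally show ?thesis .
qed

text \<open>A bounded \<open>g\<close> need not decay, so the mass of the layer of width
  \<open>s\<close> can only be made small relative to the mass inside, and only for well-chosen
  \<open>R\<close>. The volume bound of order \<open>DIM('a)\<close> provides such a radius.\<close>

lemma mass_truncation_ratio:
  assumes g: "g \<in> borel_measurable M" "\<And>x. x \<in> \<Omega> \<Longrightarrow> 0 \<le> g x" "\<And>x. x \<in> \<Omega> \<Longrightarrow> g x \<le> B"
    and pos: "x \<in> \<Omega>" "0 < g x" "continuous_on \<Omega> g" and s: "0 < s" and q: "1 < q"
  shows "\<exists>R. 0 < mass 0 R g \<and> mass 0 (R + s) g \<le> q * mass 0 R g"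
proof -
  have locint: "locint g"
  proof (rule locint_bounded[OF g(1)])
    show "\<exists>B. \<forall>y\<in>\<Omega>. norm y < R \<longrightarrow> \<bar>g y\<bar> \<le> B" for R
      using g(2,3) by (intro exI[of _ B]) auto
  qed
  have B: "0 \<le> B"
    using g(2,3) pos(1) order_trans by blast
  define D where "D = B * measure lborel (ball (0::'a) 1)"
  have bound: "mass 0 R g \<le> D * R ^ DIM('a)" if "0 < R" for R
  proof -
    have "mass 0 R g \<le> mass 0 R (\<lambda>y. B * 1)"
      using g(3) by (intro mass_mono locint locint_const) auto
    also have "\<dots> = B * mass 0 R (\<lambda>y. 1)"
      by (simp add: mass_def)
    also have "\<dots> \<le> B * measure lborel (ball (0::'a) R)"
      using mass_const_le B by (rule mult_left_mono)
    also have "\<dots> = D * R ^ DIM('a)"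
      using that content_ball_conv_unit_ball[of R "0::'a"] by (simp add: D_def)
    finally show ?thesis .
  qed
  obtain d where d: "0 < d" "\<And>y. y \<in> \<Omega> \<Longrightarrow> dist y x < d \<Longrightarrow> dist (g y) (g x) < g x / 2"
    using pos unfolding continuous_on_iff by (meson half_gt_zero)
  have "0 < g x / 2 * mass x d (\<lambda>y. 1)"
    using pos(2) mass_const_pos[OF pos(1) d(1)] by simp
  also have "\<dots> \<le> mass x d g"
  proof (rule mass_ge_const[OF locint])
    fix y assume y: "y \<in> \<Omega>" "y \<in> ball x d"
    have "dist (g y) (g x) < g x / 2"
      using y by (intro d(2)) (simp_all add: dist_commute)
    then show "g x / 2 \<le> g y"
      unfolding dist_real_def by linarith
  qed
  also have "\<dots> \<le> mass 0 (norm x + d) g"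
    using g(2) by (intro mass_ball_mono locint) (simp_all add: ball_subset_ball_iff dist_norm)
  finally have "0 < mass 0 (norm x + d) g" .
  moreover have "0 \<le> D"
    using B by (simp add: D_def)
  ultimately show ?thesis
    using polynomial_growth_ratio[OF bound, of "norm x + d" s q] d(1) s q
    by (auto simp: add_nonneg_pos)
qed

lemma integrable_bounded_times_square:
  assumes a: "continuous_on \<Omega> a" "bounded (a ` \<Omega>)" and \<psi>: "L2_on \<Omega> \<psi>"
  shows "integrable M (\<lambda>x. a x * (\<psi> x)\<^sup>2)"
proof -
  obtain A where A: "\<And>x. x \<in> \<Omega> \<Longrightarrow> \<bar>a x\<bar> \<le> A"
    using a(2) by (auto simp: bounded_iff)
  show ?thesis
  proof (rule Bochner_Integration.integrable_bound)
    show "integrable M (\<lambda>x. A * (\<psi> x)\<^sup>2)"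
      using \<psi> by (simp add: L2_on_def)
    show "(\<lambda>x. a x * (\<psi> x)\<^sup>2) \<in> borel_measurable M"
      using continuous_measurable[OF a(1)] \<psi>
      by (intro borel_measurable_times borel_measurable_power) (auto simp: L2_on_def)
    show "AE x in M. norm (a x * (\<psi> x)\<^sup>2) \<le> norm (A * (\<psi> x)\<^sup>2)"
    proof (rule AE_I2)
      fix x assume "x \<in> space M"
      then have "\<bar>a x\<bar> \<le> \<bar>A\<bar>"
        using A[of x] by simp
      then show "norm (a x * (\<psi> x)\<^sup>2) \<le> norm (A * (\<psi> x)\<^sup>2)"
        by (simp add: abs_mult mult_right_mono)
    qed
  qed
qed

text \<open>Test with \<open>\<phi>\<close> cut off sharply at radius \<open>R\<close>, which is
  allowed in L2. The error is the pairing of the truncation with \<open>L\<close> of the adjacent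
  layer, and is at most \<open>e\<close> times the squared norm of the truncation.\<close>

lemma lambda_v_le_of_subsolution:
  assumes a: "continuous_on \<Omega> a" "bounded (a ` \<Omega>)"
    and \<phi>: "continuous_on \<Omega> \<phi>" "bounded (\<phi> ` \<Omega>)" "\<And>x. x \<in> \<Omega> \<Longrightarrow> 0 \<le> \<phi> x" "\<exists>x\<in>\<Omega>. \<phi> x \<noteq> 0"
    and sub: "\<And>x. x \<in> \<Omega> \<Longrightarrow> 0 \<le> L \<phi> x + (a x + l) * \<phi> x"
  shows "lambda_v \<Omega> K a \<le> ereal l"
proof (rule ereal_le_epsilon2)
  fix e :: real assume e: "0 < e"
  define V where "V = measure lborel (ball (0::'a) r0)"
  have V: "0 < V"
    unfolding V_def using r0_pos by (rule content_ball_pos)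
  \<comment> \<open>The layer will have squared norm at most \<open>t\<^sup>2 * I R\<close>, so both
    Young terms are at most \<open>t * I R\<close> and the total error is
    \<open>C0 * V * t * I R = e * I R\<close>.\<close>
  define t where "t = e / (C0 * V)"
  have t: "0 < t" "C0 * V * t = e"
    using e V C0_pos by (auto simp: t_def)
  obtain B where B: "\<And>x. x \<in> \<Omega> \<Longrightarrow> \<phi> x \<le> B"
    using \<phi>(2) unfolding bounded_iff by (metis abs_ge_self imageI order_trans real_norm_def)
  have \<phi>_meas: "\<phi> \<in> borel_measurable M"
    using \<phi>(1) by (rule continuous_measurable)
  have \<phi>_locint: "locint \<phi>"
  proof (rule locint_bounded[OF \<phi>_meas])
    show "\<exists>B. \<forall>y\<in>\<Omega>. norm y < R \<longrightarrow> \<bar>\<phi> y\<bar> \<le> B" for R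
      using \<phi>(3) B by (intro exI[of _ B]) auto
  qed
  have \<phi>2_le: "(\<phi> x)\<^sup>2 \<le> B\<^sup>2" if "x \<in> \<Omega>" for x
    using B[OF that] \<phi>(3)[OF that] by (rule power_mono)
  have \<phi>2_meas: "(\<lambda>x. (\<phi> x)\<^sup>2) \<in> borel_measurable M"
    using \<phi>_meas by measurable
  have \<phi>2_locint: "locint (\<lambda>x. (\<phi> x)\<^sup>2)"
  proof (rule locint_bounded[OF \<phi>2_meas])
    show "\<exists>B. \<forall>y\<in>\<Omega>. norm y < R \<longrightarrow> \<bar>(\<phi> y)\<^sup>2\<bar> \<le> B" for R
      using \<phi>2_le by (intro exI[of _ "B\<^sup>2"]) auto
  qed
  obtain x where x: "x \<in> \<Omega>" "0 < (\<phi> x)\<^sup>2"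
    using \<phi>(4) by auto
  define I where "I R = mass 0 R (\<lambda>x. (\<phi> x)\<^sup>2)" for R
  obtain R where R: "0 < I R" "I (R + r0) \<le> (1 + t\<^sup>2) * I R"
    using mass_truncation_ratio[OF \<phi>2_meas _ \<phi>2_le x _ r0_pos, of "1 + t\<^sup>2"] \<phi>(1) t(1)
    unfolding I_def by (auto intro: continuous_on_power)
  define \<psi> where "\<psi> x = indicator (ball 0 R) x * \<phi> x" for x
  \<comment> \<open>The range of \<open>K\<close> is \<open>r0\<close>, so inside the ball of radius
    \<open>R\<close> the operator sees only \<open>\<psi>\<close> and this layer.\<close>
  define \<eta> where "\<eta> x = indicator (ball 0 (R + r0)) x * \<phi> x - \<psi> x" for x
  have sub_ball: "x \<in> ball 0 R \<Longrightarrow> x \<in> ball 0 (R + r0)" for x :: 'a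
    using r0_pos by simp
  have \<psi>_L2: "L2_on \<Omega> \<psi>"
    unfolding \<psi>_def using \<phi>_meas \<phi>2_locint by (rule L2_on_indicator_ball)
  have \<psi>_sq: "(\<psi> x)\<^sup>2 = indicator (ball 0 R) x * (\<phi> x)\<^sup>2" for x
    by (simp add: \<psi>_def indicator_def)
  have \<eta>_sq: "(\<eta> x)\<^sup>2 = indicator (ball 0 (R + r0)) x * (\<phi> x)\<^sup>2 - indicator (ball 0 R) x * (\<phi> x)\<^sup>2" for x
    using sub_ball[of x] by (cases "x \<in> ball 0 R") (auto simp: \<eta>_def \<psi>_def indicator_def)
  have \<psi>_int: "(\<integral>x. (\<psi> x)\<^sup>2 \<partial>M) = I R"
    by (simp add: \<psi>_sq I_def mass_def)
  have \<eta>_int: "integrable M (\<lambda>x. (\<eta> x)\<^sup>2)" "(\<integral>x. (\<eta> x)\<^sup>2 \<partial>M) = I (R + r0) - I R"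
    unfolding \<eta>_sq I_def mass_def using locint_ball[OF \<phi>2_locint] by simp_all
  have "\<eta> \<in> borel_measurable M"
    unfolding \<eta>_def \<psi>_def using \<phi>_meas by measurable
  with \<eta>_int(1) have \<eta>_L2: "L2_on \<Omega> \<eta>"
    by (simp add: L2_on_def)
  note quad = L_quadratic_bound[OF \<psi>_L2 \<eta>_L2 t(1), folded V_def]
  have "\<bar>\<integral>x. L \<eta> x * \<psi> x \<partial>M\<bar> \<le> C0 * V / 2 * (t * I R + (I (R + r0) - I R) / t)"
    using quad(2) by (simp add: \<psi>_int \<eta>_int(2))
  also have "\<dots> \<le> C0 * V / 2 * (t * I R + t * I R)"
  proof -
    have "(I (R + r0) - I R) / t \<le> t * I R"
      using R(2) t(1) by (simp add: field_simps power2_eq_square)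
    then show ?thesis
      using C0_pos V by (intro mult_left_mono) auto
  qed
  also have "\<dots> = e * I R"
    unfolding t(2)[symmetric] by simp
  finally have err: "\<bar>\<integral>x. L \<eta> x * \<psi> x \<partial>M\<bar> \<le> e * I R" .
  have a_int: "integrable M (\<lambda>x. a x * (\<psi> x)\<^sup>2)"
    using a \<psi>_L2 by (rule integrable_bounded_times_square)
  have lower: "- l * (\<psi> x)\<^sup>2 - L \<eta> x * \<psi> x \<le> (L \<psi> x + a x * \<psi> x) * \<psi> x" if x: "x \<in> \<Omega>" for x
  proof (cases "x \<in> ball 0 R")
    case True
    have "L \<phi> x = L (\<lambda>y. \<psi> y + \<eta> y) x"
      unfolding nlop_def
    proof (rule Bochner_Integration.integral_cong[OF refl])
      fix y assume "y \<in> space M"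
      then have y: "y \<in> \<Omega>" by simp
      have "ball x r0 \<subseteq> ball 0 (R + r0)"
        using True by (simp add: ball_subset_ball_iff dist_norm)
      then have "K x y = 0" if "y \<notin> ball 0 (R + r0)"
        using K_le[OF x y] K_nonneg[OF x y] that by (cases "y \<in> ball x r0") auto
      then show "K x y * \<phi> y = K x y * (\<psi> y + \<eta> y)"
        by (cases "y \<in> ball 0 (R + r0)") (auto simp: \<eta>_def)
    qed
    then have "L \<phi> x = L \<psi> x + L \<eta> x"
      using x \<psi>_L2 \<eta>_L2 by (simp add: L_add L2_locint)
    then have "- l * \<phi> x - L \<eta> x \<le> L \<psi> x + a x * \<phi> x"
      using sub[OF x] by (simp add: algebra_simps)
    then have "(- l * \<phi> x - L \<eta> x) * \<phi> x \<le> (L \<psi> x + a x * \<phi> x) * \<phi> x"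
      using \<phi>(3)[OF x] by (rule mult_right_mono)
    then show ?thesis
      using True by (simp add: \<psi>_def power2_eq_square algebra_simps)
  qed (simp add: \<psi>_def)
  have int_\<psi>: "integrable M (\<lambda>x. L \<psi> x * \<psi> x)"
    using L_quadratic_bound(1)[OF \<psi>_L2 \<psi>_L2 t(1)] .
  have "- l * I R - (\<integral>x. L \<eta> x * \<psi> x \<partial>M) = (\<integral>x. - l * (\<psi> x)\<^sup>2 - L \<eta> x * \<psi> x \<partial>M)"
    using quad(1) \<psi>_L2 by (simp add: \<psi>_int L2_on_def)
  also have "\<dots> \<le> (\<integral>x. (L \<psi> x + a x * \<psi> x) * \<psi> x \<partial>M)"
    using quad(1) \<psi>_L2 int_\<psi> a_int lower
    by (intro integral_mono) (auto simp: L2_on_def distrib_right power2_eq_square mult.assoc)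
  finally have "- (l + e) * I R \<le> (\<integral>x. (L \<psi> x + a x * \<psi> x) * \<psi> x \<partial>M)"
    using err by (simp add: algebra_simps abs_le_iff)
  then have "lambda_v \<Omega> K a \<le> ereal (l + e)"
    using \<psi>_L2 R(1) by (intro lambda_v_le_ereal[of \<psi>]) (simp_all add: \<psi>_int)
  then show "lambda_v \<Omega> K a \<le> ereal l + ereal e" by simp
qed

lemma lambda_v_le_lambda_p':
  assumes "continuous_on \<Omega> a" "bounded (a ` \<Omega>)"
  shows "lambda_v \<Omega> K a \<le> lambda_p' \<Omega> K a"
  unfolding lambda_p'_def by (rule Inf_greatest) (use lambda_v_le_of_subsolution[OF assms] in blast)

text \<open>A Caratheodory argument: \<open>K\<close> is the limit of kernels that are piecewise constant in the
  first variable, off the null set of \<open>y\<close> for which \<open>\<lambda>x. K x y\<close> fails to be continuous.\<close>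

lemma kernel_joint_measurable:
  "\<exists>N\<in>null_sets M. (\<lambda>(x, y). indicator (- N) y * K x y) \<in> borel_measurable (M \<Otimes>\<^sub>M M)"
proof -
  obtain N where N: "N \<in> null_sets M" "{y \<in> space M. \<not> uniformly_continuous_on \<Omega> (\<lambda>x. K x y)} \<subseteq> N"
    using K_ucont unfolding eventually_ae_filter by blast
  obtain D where D: "countable D" "D \<subseteq> \<Omega>" "\<Omega> \<subseteq> closure D"
    using separable by metis
  have "D \<noteq> {}"
    using D(3) nonempty_dom by auto
  define q where "q = from_nat_into D"
  have q: "q i \<in> \<Omega>" for i
    using from_nat_into[OF \<open>D \<noteq> {}\<close>] D(2) by (auto simp: q_def)
  have q_dense: "\<exists>i. dist x (q i) < e" if x: "x \<in> \<Omega>" "0 < e" for x e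
  proof -
    have "x \<in> closure D"
      using D(3) x(1) by blast
    then obtain y where y: "y \<in> D" "dist y x < e"
      using x(2) unfolding closure_approachable by blast
    obtain i where "q i = y"
      using from_nat_into_surj[OF D(1) y(1)] by (auto simp: q_def)
    with y(2) show ?thesis
      by (intro exI[of _ i]) (simp add: dist_commute)
  qed
  \<comment> \<open>Taking the least index makes the choice of a nearby dense point measurable with
    countably many values.\<close>
  define j where "j n x = (LEAST i. dist x (q i) < inverse (real (Suc n)))" for n :: nat and x
  have j: "dist x (q (j n x)) < inverse (real (Suc n))" if "x \<in> \<Omega>" for n x
    unfolding j_def by (rule LeastI_ex[of "\<lambda>i. dist x (q i) < inverse (real (Suc n))"]) (simp add: q_dense that)
  have j_lim: "(\<lambda>n. q (j n x)) \<longlonglongrightarrow> x" if "x \<in> \<Omega>" for x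
  proof (rule metric_tendsto_imp_tendsto[OF LIMSEQ_inverse_real_of_nat])
    show "\<forall>\<^sub>F n in sequentially. dist (q (j n x)) x \<le> dist (inverse (real (Suc n))) 0"
      using j[OF that] by (intro always_eventually allI) (simp add: dist_commute less_imp_le)
  qed
  have j_meas: "j n \<in> M \<rightarrow>\<^sub>M count_space UNIV" for n
    unfolding j_def
  proof (rule measurable_Least)
    fix i
    note [measurable] = ident_measurable
    show "Measurable.pred M (\<lambda>x. dist x (q i) < inverse (real (Suc n)))"
      by measurable
  qed
  have N_meas: "(\<lambda>y. indicator (- N) y * K (q i) y) \<in> borel_measurable M" for i
  proof -
    have "(\<lambda>y. indicator (\<Omega> - N) y * K (q i) y) \<in> borel_measurable M
        \<longleftrightarrow> (\<lambda>y. indicator (- N) y * K (q i) y) \<in> borel_measurable M"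
      by (rule measurable_cong) (simp add: indicator_def)
    moreover have "(\<lambda>y. indicator (\<Omega> - N) y * K (q i) y) \<in> borel_measurable M"
      using sets.compl_sets[OF null_setsD2[OF N(1)]] K_meas[OF q] by simp
    ultimately show ?thesis
      by blast
  qed
  have "(\<lambda>(x, y). indicator (- N) y * K x y) \<in> borel_measurable (M \<Otimes>\<^sub>M M)"
  proof (rule borel_measurable_LIMSEQ_metric)
    show "(\<lambda>p. indicator (- N) (snd p) * K (q (j n (fst p))) (snd p)) \<in> borel_measurable (M \<Otimes>\<^sub>M M)" for n
      by (rule measurable_compose_countable[of "\<lambda>i p. indicator (- N) (snd p) * K (q i) (snd p)"])
        (rule measurable_compose[OF measurable_snd N_meas], rule measurable_compose[OF measurable_fst j_meas])
    fix p assume p: "p \<in> space (M \<Otimes>\<^sub>M M)"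
    obtain x y where xy: "p = (x, y)" "x \<in> \<Omega>" "y \<in> \<Omega>"
      using p by (auto simp: space_pair_measure)
    have "(\<lambda>n. indicator (- N) y * K (q (j n x)) y) \<longlonglongrightarrow> indicator (- N) y * K x y"
    proof (cases "y \<in> N")
      case False
      then have "continuous_on \<Omega> (\<lambda>x. K x y)"
        using N(2) xy(3) by (auto intro: uniformly_continuous_imp_continuous)
      then have "(\<lambda>n. K (q (j n x)) y) \<longlonglongrightarrow> K x y"
        by (rule continuous_on_tendsto_compose[OF _ j_lim[OF xy(2)] xy(2)]) (simp add: q)
      then show ?thesis by (rule tendsto_mult_left)
    qed simp
    then show "(\<lambda>n. indicator (- N) (snd p) * K (q (j n (fst p))) (snd p)) \<longlonglongrightarrow> (case p of (x, y) \<Rightarrow> indicator (- N) y * K x y)"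
      by (simp add: xy(1))
  qed
  with N(1) show ?thesis by blast
qed

section \<open>Symmetric kernels and the lower bound for the Rayleigh quotient\<close>

lemma ennreal_L:
  assumes "locint v" "\<And>y. y \<in> \<Omega> \<Longrightarrow> 0 \<le> v y" "x \<in> \<Omega>"
  shows "ennreal (L v x) = (\<integral>\<^sup>+y. ennreal (K x y * v y) \<partial>M)"
  unfolding nlop_def
  by (rule nn_integral_eq_integral[symmetric, OF K_integrable]) (use assms K_nonneg in auto)

text \<open>Stated with nonnegative integrals so that Tonelli applies: in the application one factor
  is a supersolution of unrestricted growth, and finiteness is known for neither side in
  advance.\<close>

lemma symmetric_L:
  assumes sym: "\<And>x y. x \<in> \<Omega> \<Longrightarrow> y \<in> \<Omega> \<Longrightarrow> K x y = K y x"
    and u: "locint u" "\<And>y. y \<in> \<Omega> \<Longrightarrow> 0 \<le> u y" and v: "locint v" "\<And>y. y \<in> \<Omega> \<Longrightarrow> 0 \<le> v y"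
  shows "(\<integral>\<^sup>+x. ennreal (u x * L v x) \<partial>M) = (\<integral>\<^sup>+y. ennreal (v y * L u y) \<partial>M)"
proof -
  interpret pair_sigma_finite M M by (rule pair_sigma_finite_M)
  obtain N where N: "N \<in> null_sets M" "(\<lambda>(x, y). indicator (- N) y * K x y) \<in> borel_measurable (M \<Otimes>\<^sub>M M)"
    using kernel_joint_measurable by blast
  have N_AE: "AE y in M. y \<notin> N"
    using N(1) by (rule AE_not_in)
  \<comment> \<open>Removing \<open>N\<close> from the variable \<open>y\<close> is harmless on both
    sides: \<open>y\<close> is the inner variable of one iterated integral and the outer variable of
    the other.\<close>
  define F where "F x y = ennreal (u x * ((indicator (- N) y * K x y) * v y))" for x y
  have "case_prod F \<in> borel_measurable (M \<Otimes>\<^sub>M M)"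
  proof -
    have "(\<lambda>p. u (fst p) * ((case p of (x, y) \<Rightarrow> indicator (- N) y * K x y) * v (snd p))) \<in> borel_measurable (M \<Otimes>\<^sub>M M)"
      using N(2) measurable_compose[OF measurable_fst locint_measurable[OF u(1)]]
        measurable_compose[OF measurable_snd locint_measurable[OF v(1)]]
      by (intro borel_measurable_times)
    then show ?thesis
      by (simp add: F_def split_beta')
  qed
  from Fubini'[OF this]
  have swap: "(\<integral>\<^sup>+y. \<integral>\<^sup>+x. F x y \<partial>M \<partial>M) = (\<integral>\<^sup>+x. \<integral>\<^sup>+y. F x y \<partial>M \<partial>M)" .
  have "(\<integral>\<^sup>+x. ennreal (u x * L v x) \<partial>M) = (\<integral>\<^sup>+x. \<integral>\<^sup>+y. F x y \<partial>M \<partial>M)"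
  proof (rule nn_integral_cong)
    fix x assume "x \<in> space M"
    then have x: "x \<in> \<Omega>" by simp
    have "ennreal (u x * L v x) = ennreal (u x) * (\<integral>\<^sup>+y. ennreal (K x y * v y) \<partial>M)"
      using u(2)[OF x] L_nonneg[OF x v(2)] ennreal_L[OF v x] by (simp add: ennreal_mult)
    also have "\<dots> = (\<integral>\<^sup>+y. ennreal (u x) * ennreal (K x y * v y) \<partial>M)"
      using K_integrable[OF v(1) x] by (intro nn_integral_cmult[symmetric]) auto
    also have "\<dots> = (\<integral>\<^sup>+y. F x y \<partial>M)"
      using N_AE AE_space
      by (intro nn_integral_cong_AE, eventually_elim)
        (use x u v K_nonneg in \<open>auto simp: F_def ennreal_mult'' ennreal_mult\<close>)
    finally show "ennreal (u x * L v x) = (\<integral>\<^sup>+y. F x y \<partial>M)" .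
  qed
  also have "\<dots> = (\<integral>\<^sup>+y. ennreal (v y * L u y) \<partial>M)"
    unfolding swap[symmetric]
  proof (rule nn_integral_cong_AE, use N_AE AE_space in eventually_elim)
    fix y assume "y \<notin> N" "y \<in> space M"
    then have y: "y \<in> \<Omega>" "indicator (- N) y = (1::real)" by auto
    have "ennreal (v y * L u y) = ennreal (v y) * (\<integral>\<^sup>+x. ennreal (K y x * u x) \<partial>M)"
      using v(2)[OF y(1)] L_nonneg[OF y(1) u(2)] ennreal_L[OF u y(1)] by (simp add: ennreal_mult)
    also have "\<dots> = (\<integral>\<^sup>+x. ennreal (v y) * ennreal (K y x * u x) \<partial>M)"
      using K_integrable[OF u(1) y(1)] by (intro nn_integral_cmult[symmetric]) auto
    also have "\<dots> = (\<integral>\<^sup>+x. F x y \<partial>M)"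
    proof (rule nn_integral_cong)
      fix x assume "x \<in> space M"
      then have x: "x \<in> \<Omega>" by simp
      have "ennreal (v y) * ennreal (K y x * u x) = ennreal (v y * (K y x * u x))"
        using v(2)[OF y(1)] u(2)[OF x] K_nonneg[OF y(1) x] by (simp add: ennreal_mult)
      also have "\<dots> = F x y"
        by (simp add: F_def y(2) sym[OF x y(1)] mult_ac)
      finally show "ennreal (v y) * ennreal (K y x * u x) = F x y" .
    qed
    finally show "(\<integral>\<^sup>+x. F x y \<partial>M) = ennreal (v y * L u y)" by simp
  qed
  finally show ?thesis .
qed

text \<open>A nonlocal Picone inequality. With \<open>g = \<psi>\<^sup>2 / \<phi>\<close>, expanding
  the square of \<open>\<psi> x * \<phi> y - \<psi> y * \<phi> x\<close> bounds the product
  \<open>\<psi> x * \<psi> y\<close> by the mean of \<open>g x * \<phi> y\<close> and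
  \<open>\<phi> x * g y\<close>. By symmetry both parts have the same integral, and the
  supersolution inequality evaluates it.\<close>

lemma rayleigh_le_of_supersolution:
  assumes sym: "\<And>x y. x \<in> \<Omega> \<Longrightarrow> y \<in> \<Omega> \<Longrightarrow> K x y = K y x"
    and a: "continuous_on \<Omega> a" "bounded (a ` \<Omega>)"
    and \<phi>: "continuous_on (closure \<Omega>) \<phi>" "\<And>x. x \<in> closure \<Omega> \<Longrightarrow> 0 < \<phi> x"
    and super: "\<And>x. x \<in> \<Omega> \<Longrightarrow> L \<phi> x + a x * \<phi> x + l * \<phi> x \<le> 0"
    and \<psi>: "L2_on \<Omega> \<psi>"
  shows "(\<integral>x. (L \<psi> x + a x * \<psi> x) * \<psi> x \<partial>M) \<le> - l * (\<integral>x. (\<psi> x)\<^sup>2 \<partial>M)"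
proof -
  have \<phi>_pos: "0 < \<phi> x" if "x \<in> \<Omega>" for x
    using \<phi>(2) that closure_subset by blast
  have \<phi>_locint: "locint \<phi>"
    using \<phi>(1) by (rule locint_continuous)
  define g where "g x = (\<psi> x)\<^sup>2 / \<phi> x" for x
  have g_nonneg: "0 \<le> g x" if "x \<in> \<Omega>" for x
    using \<phi>_pos[OF that] by (simp add: g_def)
  have \<psi>2: "integrable M (\<lambda>x. (\<psi> x)\<^sup>2)"
    using \<psi> by (simp add: L2_on_def)
  have g_meas: "g \<in> borel_measurable M"
    unfolding g_def using locint_measurable[OF \<phi>_locint] \<psi>
    by (intro borel_measurable_divide borel_measurable_power) (auto simp: L2_on_def)
  \<comment> \<open>Positivity of \<open>\<phi>\<close> on the closure keeps
    \<open>1 / \<phi>\<close> bounded on bounded sets, up to the boundary.\<close>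
  have g_locint: "locint g"
    unfolding locint_def
  proof (intro conjI allI g_meas)
    fix R
    have "compact (closure \<Omega> \<inter> cball 0 R)"
      by (simp add: closed_Int_compact)
    then have "bounded ((\<lambda>x. 1 / \<phi> x) ` (closure \<Omega> \<inter> cball 0 R))"
      using \<phi> by (intro compact_imp_bounded compact_continuous_image continuous_on_divide)
        (auto simp: less_le intro: continuous_on_subset)
    then obtain B where B: "\<And>x. x \<in> closure \<Omega> \<inter> cball 0 R \<Longrightarrow> \<bar>1 / \<phi> x\<bar> \<le> B"
      by (metis bounded_iff imageI real_norm_def)
    show "integrable M (\<lambda>x. indicator (ball 0 R) x * g x)"
    proof (rule Bochner_Integration.integrable_bound)
      show "integrable M (\<lambda>x. B * (\<psi> x)\<^sup>2)"
        using \<psi>2 by simp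
      show "(\<lambda>x. indicator (ball 0 R) x * g x) \<in> borel_measurable M"
        using g_meas by measurable
      show "AE x in M. norm (indicator (ball 0 R) x * g x) \<le> norm (B * (\<psi> x)\<^sup>2)"
      proof (rule AE_I2)
        fix x assume "x \<in> space M"
        then have x: "x \<in> \<Omega>" by simp
        show "norm (indicator (ball 0 R) x * g x) \<le> norm (B * (\<psi> x)\<^sup>2)"
        proof (cases "x \<in> ball 0 R")
          case True
          then have "x \<in> closure \<Omega> \<inter> cball 0 R"
            using x closure_subset[of \<Omega>] by auto
          then have "\<bar>1 / \<phi> x\<bar> * (\<psi> x)\<^sup>2 \<le> B * (\<psi> x)\<^sup>2"
            using B by (intro mult_right_mono) auto
          also have "\<dots> \<le> norm (B * (\<psi> x)\<^sup>2)"
            by simp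
          finally show ?thesis
            using True by (simp add: g_def)
        qed simp
      qed
    qed
  qed
  have a_int: "integrable M (\<lambda>x. a x * (\<psi> x)\<^sup>2)"
    using a \<psi> by (rule integrable_bounded_times_square)
  \<comment> \<open>Multiplying the supersolution inequality by \<open>g\<close> cancels
    \<open>\<phi>\<close> and leaves this integrable majorant. It is the source of all finiteness
    below.\<close>
  define h where "h x = - (a x * (\<psi> x)\<^sup>2 + l * (\<psi> x)\<^sup>2)" for x
  have h_int: "integrable M h"
    unfolding h_def using a_int \<psi>2 by simp
  have gL: "0 \<le> g x * L \<phi> x" "g x * L \<phi> x \<le> h x" if x: "x \<in> \<Omega>" for x
  proof -
    show "0 \<le> g x * L \<phi> x"
      using g_nonneg[OF x] L_nonneg[OF x] \<phi>_pos by (simp add: less_imp_le)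
    have "g x * L \<phi> x \<le> g x * (- (a x * \<phi> x + l * \<phi> x))"
      using super[OF x] g_nonneg[OF x] by (intro mult_left_mono) auto
    also have "\<dots> = h x"
      using \<phi>_pos[OF x] by (simp add: g_def h_def field_simps)
    finally show "g x * L \<phi> x \<le> h x" .
  qed
  have gL_meas: "(\<lambda>x. g x * L \<phi> x) \<in> borel_measurable M"
    using g_meas continuous_measurable[OF L_continuous[OF \<phi>_locint]] by simp
  have gL_int: "integrable M (\<lambda>x. g x * L \<phi> x)"
    by (rule Bochner_Integration.integrable_bound[OF h_int gL_meas])
      (rule AE_I2, use gL in \<open>fastforce intro: order_trans\<close>)
  have Lg_meas: "(\<lambda>x. \<phi> x * L g x) \<in> borel_measurable M"
    using locint_measurable[OF \<phi>_locint] continuous_measurable[OF L_continuous[OF g_locint]] by simp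
  have Lg_nonneg: "0 \<le> \<phi> x * L g x" if "x \<in> \<Omega>" for x
    using \<phi>_pos[OF that] L_nonneg[OF that g_nonneg] by simp
  \<comment> \<open>Symmetry transfers finiteness, as well as the value, from
    \<open>g * L \<phi>\<close> to \<open>\<phi> * L g\<close>, for which no direct majorant is
    available.\<close>
  have "(\<integral>\<^sup>+x. ennreal (\<phi> x * L g x) \<partial>M) = (\<integral>\<^sup>+x. ennreal (g x * L \<phi> x) \<partial>M)"
    by (rule symmetric_L[OF sym \<phi>_locint less_imp_le[OF \<phi>_pos] g_locint g_nonneg])
  also have "\<dots> = ennreal (\<integral>x. g x * L \<phi> x \<partial>M)"
    using gL_int gL(1) by (intro nn_integral_eq_integral) auto
  finally have nn: "(\<integral>\<^sup>+x. ennreal (\<phi> x * L g x) \<partial>M) = ennreal (\<integral>x. g x * L \<phi> x \<partial>M)" .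
  have Lg_int: "integrable M (\<lambda>x. \<phi> x * L g x)"
    using Lg_meas Lg_nonneg nn by (intro integrableI_nonneg) auto
  have Lg_eq: "(\<integral>x. \<phi> x * L g x \<partial>M) = (\<integral>x. g x * L \<phi> x \<partial>M)"
    using nn Lg_meas Lg_nonneg gL(1)
    by (subst integral_eq_nn_integral) (auto intro!: enn2real_ennreal integral_nonneg_AE)
  have young: "L \<psi> x * \<psi> x \<le> (g x * L \<phi> x + \<phi> x * L g x) / 2" if x: "x \<in> \<Omega>" for x
  proof -
    have "L \<psi> x * \<psi> x = L (\<lambda>y. \<psi> x * \<psi> y) x"
      unfolding L_cmult by (rule mult.commute)
    also have "\<dots> \<le> L (\<lambda>y. g x / 2 * \<phi> y + \<phi> x / 2 * g y) x"
    proof (rule L_mono[OF _ _ x])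
      show "locint (\<lambda>y. \<psi> x * \<psi> y)"
        using L2_locint[OF \<psi>] by (rule locint_cmult)
      show "locint (\<lambda>y. g x / 2 * \<phi> y + \<phi> x / 2 * g y)"
        by (intro locint_add locint_cmult \<phi>_locint g_locint)
      fix y assume y: "y \<in> \<Omega>"
      have "0 \<le> (\<psi> x * \<phi> y - \<psi> y * \<phi> x)\<^sup>2 / (2 * \<phi> x * \<phi> y)"
        using \<phi>_pos[OF x] \<phi>_pos[OF y] by simp
      also have "\<dots> = g x / 2 * \<phi> y + \<phi> x / 2 * g y - \<psi> x * \<psi> y"
        using \<phi>_pos[OF x] \<phi>_pos[OF y] by (simp add: g_def field_simps power2_eq_square)
      finally show "\<psi> x * \<psi> y \<le> g x / 2 * \<phi> y + \<phi> x / 2 * g y"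
        by simp
    qed
    also have "\<dots> = g x / 2 * L \<phi> x + \<phi> x / 2 * L g x"
      by (simp only: L_add[OF locint_cmult[OF \<phi>_locint] locint_cmult[OF g_locint] x] L_cmult)
    finally show ?thesis
      by (simp add: field_simps)
  qed
  have L\<psi>_int: "integrable M (\<lambda>x. L \<psi> x * \<psi> x)"
    by (rule L_quadratic_bound(1)[OF \<psi> \<psi> zero_less_one])
  have "(\<integral>x. L \<psi> x * \<psi> x \<partial>M) \<le> (\<integral>x. (g x * L \<phi> x + \<phi> x * L g x) / 2 \<partial>M)"
    using L\<psi>_int gL_int Lg_int young by (intro integral_mono) auto
  also have "\<dots> = (\<integral>x. g x * L \<phi> x \<partial>M)"
    using gL_int Lg_int Lg_eq by simp
  also have "\<dots> \<le> (\<integral>x. h x \<partial>M)"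
    using gL_int h_int gL(2) by (intro integral_mono) auto
  also have "\<dots> = - (\<integral>x. a x * (\<psi> x)\<^sup>2 \<partial>M) - l * (\<integral>x. (\<psi> x)\<^sup>2 \<partial>M)"
    unfolding h_def using a_int \<psi>2 by simp
  finally have "(\<integral>x. L \<psi> x * \<psi> x \<partial>M) + (\<integral>x. a x * (\<psi> x)\<^sup>2 \<partial>M) \<le> - l * (\<integral>x. (\<psi> x)\<^sup>2 \<partial>M)"
    by simp
  moreover have "(\<integral>x. (L \<psi> x + a x * \<psi> x) * \<psi> x \<partial>M) = (\<integral>x. L \<psi> x * \<psi> x + a x * (\<psi> x)\<^sup>2 \<partial>M)"
    by (simp add: distrib_right power2_eq_square mult.assoc)
  ultimately show ?thesis
    using L\<psi>_int a_int by simp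
qed

lemma lambda_p_le_lambda_v:
  assumes sym: "\<And>x y. x \<in> \<Omega> \<Longrightarrow> y \<in> \<Omega> \<Longrightarrow> K x y = K y x"
    and a: "continuous_on \<Omega> a" "bounded (a ` \<Omega>)"
  shows "lambda_p \<Omega> K a \<le> lambda_v \<Omega> K a"
  unfolding lambda_p_def lambda_v_def
proof (intro Sup_least Inf_greatest, clarify)
  fix l \<phi> \<psi>
  assume \<phi>: "continuous_on (closure \<Omega>) \<phi>" "\<forall>x\<in>closure \<Omega>. 0 < \<phi> x"
    "\<forall>x\<in>\<Omega>. L \<phi> x + a x * \<phi> x + l * \<phi> x \<le> 0"
    and \<psi>: "L2_on \<Omega> \<psi>" "\<not> (AE x in M. \<psi> x = 0)"
  have "(\<integral>x. (\<psi> x)\<^sup>2 \<partial>M) \<noteq> 0"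
    using \<psi> integral_nonneg_eq_0_iff_AE[of M "\<lambda>x. (\<psi> x)\<^sup>2"] by (simp add: L2_on_def)
  then have "0 < (\<integral>x. (\<psi> x)\<^sup>2 \<partial>M)"
    by (simp add: less_le)
  moreover have "(\<integral>x. (L \<psi> x + a x * \<psi> x) * \<psi> x \<partial>M) \<le> - l * (\<integral>x. (\<psi> x)\<^sup>2 \<partial>M)"
    using \<phi> \<psi>(1) by (intro rayleigh_le_of_supersolution[OF sym a, of \<phi>]) auto
  ultimately show "ereal l \<le> ereal (- (\<integral>x. (L \<psi> x + a x * \<psi> x) * \<psi> x \<partial>M) / (\<integral>x. (\<psi> x)\<^sup>2 \<partial>M))"
    by (simp add: field_simps)
qed

end

theorem theorem1p2:
  fixes \<Omega> :: "'a::euclidean_space set"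
    and K :: "'a \<Rightarrow> 'a \<Rightarrow> real"
    and a :: "'a \<Rightarrow> real"
    and r0 r1 C0 c0 :: real
  assumes dom: "open \<Omega>" "connected \<Omega>" "\<not> bounded \<Omega>"
    and a_cont: "continuous_on (closure \<Omega>) a"
    and a_bdd: "bounded (a ` \<Omega>)"
    and K_nonneg: "\<forall>x\<in>\<Omega>. \<forall>y\<in>\<Omega>. K x y \<ge> 0"
    and K_meas: "\<forall>x\<in>\<Omega>. (\<lambda>y. K x y) \<in> borel_measurable (lebesgue_on \<Omega>)"
    and K_ucont: "AE y in lebesgue_on \<Omega>. uniformly_continuous_on \<Omega> (\<lambda>x. K x y)"
    and rc_pos: "r0 \<ge> r1" "r1 > 0" "C0 \<ge> c0" "c0 > 0"
    and K_bounds: "\<forall>x\<in>\<Omega>. \<forall>y\<in>\<Omega>.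
        C0 * indicator (\<Omega> \<inter> ball x r0) y \<ge> K x y \<and>
        K x y \<ge> c0 * indicator (\<Omega> \<inter> ball x r1) y"
  shows "lambda_p' \<Omega> K a \<le> lambda_p'' \<Omega> K a \<and> lambda_p'' \<Omega> K a \<le> lambda_p \<Omega> K a \<and>
    (((\<forall>x\<in>\<Omega>. \<forall>y\<in>\<Omega>. K x y = K y x) \<and>
      (\<lambda>x. integral\<^sup>L (lebesgue_on \<Omega>) (\<lambda>y. K x y)) \<in> borel_measurable (lebesgue_on \<Omega>) \<and>
      (\<exists>M. AE x in lebesgue_on \<Omega>. \<bar>integral\<^sup>L (lebesgue_on \<Omega>) (\<lambda>y. K x y)\<bar> \<le> M))
     \<longrightarrow> lambda_v \<Omega> K a = lambda_p' \<Omega> K a \<and> lambda_p' \<Omega> K a = lambda_p'' \<Omega> K a \<and>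
         lambda_p'' \<Omega> K a = lambda_p \<Omega> K a)"
proof -
  interpret nonlocal_kernel \<Omega> K r0 r1 C0 c0
  proof
    show "\<Omega> \<noteq> {}"
      using dom(3) by auto
    show "K x y \<le> C0 * indicator (ball x r0) y" "c0 * indicator (ball x r1) y \<le> K x y"
      if "x \<in> \<Omega>" "y \<in> \<Omega>" for x y
      using K_bounds that by (auto simp: indicator_inter_arith)
  qed (use dom rc_pos K_nonneg K_meas K_ucont in auto)
  have a_dom: "continuous_on \<Omega> a"
    using a_cont closure_subset by (rule continuous_on_subset)
  note order = lambda_p'_le_lambda_p''[of \<Omega> K a] lambda_p''_le_lambda_p[OF a_cont a_bdd]
  have "lambda_v \<Omega> K a = lambda_p' \<Omega> K a \<and> lambda_p' \<Omega> K a = lambda_p'' \<Omega> K a \<and>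
      lambda_p'' \<Omega> K a = lambda_p \<Omega> K a" if "\<forall>x\<in>\<Omega>. \<forall>y\<in>\<Omega>. K x y = K y x"
  proof -
    \<comment> \<open>This inequality and \<open>lambda_v \<le> lambda_p'\<close> close the general
      order into a cycle, so all four quantities coincide.\<close>
    have "lambda_p \<Omega> K a \<le> lambda_v \<Omega> K a"
      using that by (intro lambda_p_le_lambda_v a_dom a_bdd) blast
    with order lambda_v_le_lambda_p'[OF a_dom a_bdd] show ?thesis
      by (meson order.antisym order.trans)
  qed
  with order show ?thesis by blast
qed

end
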